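(* Let $1<\beta\leq 2$. Let $\mathcal{U}_\beta$ be the set of points of $[0,\frac{1}{\beta-1}]$ having a unique $\beta$-expansion, and let $E_\beta$ be the (normalized) escape rate of the greedy $\beta$-transformation on $[0,1)$ into the hole $\Delta_\beta=[\frac1\beta,\frac{1}{\beta(\beta-1)}]$. Then $$\dim_H \mathcal{U}_\beta + E_\beta = 1,$$ where $\dim_H$ denotes Hausdorff dimension.
   Context: Let $1<\beta\le 2$ and $J_\beta=[0,\frac{1}{\beta-1}]$. A $\beta$-expansion of $x\in J_\beta$ is a sequence $(\varepsilon_n)_{n\ge1}\in\{0,1\}^{\mathbb N}$ with $x=\sum_{n\ge1}\varepsilon_n\beta^{-n}$. The univoque set $\mathcal U_\beta$ is the set of $x\in J_\beta$ having exactly one $\beta$-expansion. The greedy $\beta$-transformation $G_\beta:J_\beta\to J_\beta$ is $G_\beta(x)=\beta x$ if $0\le x<\frac1\beta$ and $G_\beta(x)=\beta x-1$ if $\frac1\beta\le x\le\frac1{\beta-1}$. Put $I=[0,1)$ and $T_\beta=G_\beta|_I: I\to I$. The hole is $\Delta_\beta=\left[\frac1\beta,\frac1{\beta(\beta-1)}\right]$. For $n\ge 0$ let $$\Gamma_{\beta,n}=\{x\in I: T_\beta^n(x)\in\Delta_\beta\cap I\text{ and }T_\beta^k(x)\notin\Delta_\beta\cap I\text{ for }0\le k\le n-1\}.$$ With $\lambda$ the Lebesgue measure on $\mathbb R$, the escape rates are $$e_\beta=\lim_{n\to\infty}\frac{-\log\lambda(\Gamma_{\beta,n})}{n},\qquad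 E_\beta=\lim_{n\to\infty}\frac{-\log\lambda(\Gamma_{\beta,n})}{n\log\beta}=\frac{e_\beta}{\log\beta}.$$
   Formalization: At β=2 the hole is the single point 1/2, every Γ_{2,n} has measure zero and the escape-rate formula contains the undefined log 0; the formal statement reads log 0 as 0, so that E_2 = 0. For 1<β<2 nothing is changed. *)

theory Defs
  imports "HOL-Analysis.Analysis"
begin

text \<open>
  The \<open>s\<close>-th power of the diameter, with the usual conventions that for \<open>s = 0\<close> a nonempty set
  (in particular a singleton) has weight 1 and the empty set has weight 0.
  (Note that \<open>0 powr 0 = 0\<close> in the library.)
\<close>

definition hausdorff_weight :: "real \<Rightarrow> 'a::metric_space set \<Rightarrow> ennreal" where
  "hausdorff_weight s U =
     (if U = {} then 0 else if s = 0 then 1 else ennreal (diameter U powr s))"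

text \<open>
  Covers are indexed by \<open>nat\<close>; finite covers are included since the members may be empty.
  Boundedness is required because \<open>diameter\<close> is only meaningful for bounded sets.
\<close>

definition hausdorff_premeasure :: "real \<Rightarrow> real \<Rightarrow> 'a::metric_space set \<Rightarrow> ennreal" where
  "hausdorff_premeasure s \<delta> A =
     (INF C \<in> {C :: nat \<Rightarrow> 'a set. A \<subseteq> (\<Union>i. C i) \<and> (\<forall>i. bounded (C i) \<and> diameter (C i) \<le> \<delta>)}.
        \<Sum>i. hausdorff_weight s (C i))"

definition hausdorff_measure :: "real \<Rightarrow> 'a::metric_space set \<Rightarrow> ennreal" where
  "hausdorff_measure s A = (SUP \<delta> \<in> {0<..}. hausdorff_premeasure s \<delta> A)"

definition hausdorff_dim :: "'a::metric_space set \<Rightarrow> ereal" where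
  "hausdorff_dim A = (INF s \<in> {s. 0 \<le> s \<and> hausdorff_measure s A = 0}. ereal s)"

text \<open>Digit sequences are indexed from 0, so \<open>\<epsilon> n\<close> is the coefficient of \<open>1 / \<beta> ^ Suc n\<close>.\<close>

definition beta_expansion :: "real \<Rightarrow> real \<Rightarrow> (nat \<Rightarrow> nat) \<Rightarrow> bool" where
  "beta_expansion \<beta> x \<epsilon> \<longleftrightarrow>
     range \<epsilon> \<subseteq> {0, 1} \<and> (\<lambda>n. real (\<epsilon> n) / \<beta> ^ Suc n) sums x"

definition univoque_set :: "real \<Rightarrow> real set" where
  "univoque_set \<beta> = {x \<in> {0..1 / (\<beta> - 1)}. \<exists>!\<epsilon>. beta_expansion \<beta> x \<epsilon>}"

text \<open>
  The formula is total on the reals, but it is only used on \<open>[0, 1/(\<beta>-1)]\<close>. For \<open>1 < \<beta> \<le> 2\<close> it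
  maps \<open>[0, 1)\<close> into itself, and its iterates on \<open>[0, 1)\<close> are those of \<open>T\<^sub>\<beta>\<close>.
\<close>

definition greedy_map :: "real \<Rightarrow> real \<Rightarrow> real" where
  "greedy_map \<beta> x = (if x < 1 / \<beta> then \<beta> * x else \<beta> * x - 1)"

definition hole :: "real \<Rightarrow> real set" where
  "hole \<beta> = {1 / \<beta> .. 1 / (\<beta> * (\<beta> - 1))}"

definition first_entry_set :: "real \<Rightarrow> nat \<Rightarrow> real set" where
  "first_entry_set \<beta> n =
     {x \<in> {0..<1}. (greedy_map \<beta> ^^ n) x \<in> hole \<beta> \<inter> {0..<1} \<and>
        (\<forall>k<n. (greedy_map \<beta> ^^ k) x \<notin> hole \<beta> \<inter> {0..<1})}"

text \<open>
  For \<open>1 < \<beta> < 2\<close> every first-entry set has positive measure. For \<open>\<beta> = 2\<close> the hole is the single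
  point \<open>1/2\<close> and all first-entry sets are null; there the library convention \<open>ln 0 = 0\<close> applies,
  so the escape rate into this null hole is 0 (almost no mass escapes).
\<close>

definition escape_seq :: "real \<Rightarrow> nat \<Rightarrow> real" where
  "escape_seq \<beta> n = - ln (measure lborel (first_entry_set \<beta> n)) / (real n * ln \<beta>)"

definition escape_rate :: "real \<Rightarrow> real" where
  "escape_rate \<beta> = lim (escape_seq \<beta>)"

end

theory Submission
  imports Defs
begin

text \<open>
  Both quantities are governed by one number, the exponential growth rate of a binary language.

  Off the hole the interval \<open>[0, 1/(\<beta>-1)]\<close> splits into a left part, where only the digit 0 is
  possible, and a right part, where only the digit 1 is possible; a point has a unique expansion
  iff its orbit never meets the hole. So a point that avoids the hole for \<open>n\<close> steps determines a
  word \<open>w\<close> of length \<open>n\<close>. It lies in \<open>cyl w\<close>, the set of all points that follow \<open>w\<close> if orbits may also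
  touch the endpoints of the hole, a closed interval of length at most \<open>\<beta>^(-n)/(\<beta>-1)\<close>. Let \<open>a n\<close> be
  the number of words of length \<open>n\<close> with nonempty \<open>cyl w\<close>, the occurring words. Subwords of occurring
  words occur, hence \<open>a (m + n) \<le> a m * a n\<close> and \<open>a n = \<beta>^((D + o(1)) n)\<close> for some \<open>D\<close>,
  with \<open>a n \<ge> \<beta>^(D n)\<close> throughout (\<open>card_words_ge_growth\<close>). The theorem follows from
  \<open>dim\<^sub>H = D\<close> and \<open>E = 1 - D\<close>. Let \<open>\<beta> < 2\<close>.

  \<^emph>\<open>Dimension.\<close> The cylinders of length \<open>n\<close> cover the univoque set, so its dimension is at most \<open>D\<close>.
  For the converse, the hole has positive length, so cylinders of distinct words of length \<open>n\<close> are
  at distance at least a constant times \<open>\<beta>^(-n)\<close> (\<open>cyl_separated\<close>). Therefore a cover of the univoque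
  set by small sets with small \<open>s\<close>-dimensional weight turns into a family of words \<open>w\<close> with
  \<open>\<Sum> \<beta>^(-s |w|) < 1\<close> such that every infinite itinerary has one of them as a prefix. By compactness
  finitely many suffice, and then, as in an argument of Furstenberg, every long word factors into
  words of this finite family up to a bounded remainder. This yields \<open>a n \<le> C \<beta>^(s n)\<close>, hence \<open>D \<le> s\<close>
  (\<open>words_growth_of_null\<close>). The compactness step is the reason for taking closed cylinders; of the points
  with an infinite itinerary only countably many, those that hit an endpoint of the hole, can fail to
  be univoque, and a countable set is null in every positive dimension.

  \<^emph>\<open>Escape rate.\<close> The first-entry set lies in the union of the cylinders of length \<open>n\<close>, so its
  measure is at most a constant times \<open>a n \<beta>^(-n)\<close>. For a lower bound, call a word branching if it can
  be continued by both digits. The image of the cylinder of a branching word then reaches across the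
  hole, so the cylinder contains an interval of length \<open>\<beta>^(-n)\<close> times that of the hole which is mapped
  into the hole after \<open>n\<close> steps. Let \<open>b n\<close> count the branching words. Removing a prefix keeps a word
  branching, so \<open>b (k + n) \<le> 2^k b n\<close>, and therefore \<open>a (n + t) \<le> a n + 2^t b n\<close>. If \<open>D > 0\<close>, choosing
  \<open>t\<close> to be a small multiple of \<open>n\<close> makes \<open>a (n + t)\<close> much larger than \<open>a n\<close> and gives
  \<open>b n \<ge> \<beta>^((D - o(1)) n)\<close>. If \<open>D = 0\<close>, the points just above \<open>\<beta>^(-n-1)\<close> already give enough measure.

  For \<open>\<beta> = 2\<close> the hole is a point: the first-entry sets are null, and the univoque set is the unit
  interval up to a countable set, so its dimension is 1.
\<close>

section \<open>Null sets of Hausdorff measure\<close>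

lemma hausdorff_weight_pos: "0 < s \<Longrightarrow> hausdorff_weight s U = ennreal (diameter U powr s)"
  by (simp add: hausdorff_weight_def)

lemma hausdorff_null_cover:
  assumes "hausdorff_measure s A = 0" "0 < \<delta>" "0 < e"
  obtains C where "A \<subseteq> (\<Union>i. C i)" "\<And>i. bounded (C i)" "\<And>i. diameter (C i) \<le> \<delta>"
    "(\<Sum>i. hausdorff_weight s (C i)) < ennreal e"
proof -
  have "hausdorff_premeasure s \<delta> A \<le> hausdorff_measure s A"
    unfolding hausdorff_measure_def using assms(2) by (intro SUP_upper) simp
  hence "hausdorff_premeasure s \<delta> A < ennreal e" using assms by simp
  thus ?thesis unfolding hausdorff_premeasure_def INF_less_iff using that by blast
qed

lemma hausdorff_nullI:
  assumes "\<And>\<delta> e. 0 < \<delta> \<Longrightarrow> 0 < e \<Longrightarrow> \<exists>C. A \<subseteq> (\<Union>i. C i) \<and>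
      (\<forall>i. bounded (C i) \<and> diameter (C i) \<le> \<delta>) \<and> (\<Sum>i. hausdorff_weight s (C i)) \<le> ennreal e"
  shows "hausdorff_measure s A = 0"
proof -
  have "hausdorff_premeasure s \<delta> A \<le> 0" if "0 < \<delta>" for \<delta>
  proof (rule ennreal_le_epsilon)
    fix e :: real assume "0 < e"
    then obtain C where "A \<subseteq> (\<Union>i. C i)" "\<forall>i. bounded (C i) \<and> diameter (C i) \<le> \<delta>"
      and le: "(\<Sum>i. hausdorff_weight s (C i)) \<le> ennreal e"
      using assms \<open>0 < \<delta>\<close> by blast
    hence "hausdorff_premeasure s \<delta> A \<le> (\<Sum>i. hausdorff_weight s (C i))"
      unfolding hausdorff_premeasure_def by (intro INF_lower) blast
    thus "hausdorff_premeasure s \<delta> A \<le> 0 + ennreal e" using le by simp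
  qed
  hence "hausdorff_measure s A \<le> 0"
    unfolding hausdorff_measure_def by (intro SUP_least) auto
  thus ?thesis by simp
qed

lemma hausdorff_null_countable:
  fixes A :: "'a::metric_space set"
  assumes "countable A" "0 < s"
  shows "hausdorff_measure s A = 0"
proof (rule hausdorff_nullI)
  fix \<delta> e :: real assume "0 < \<delta>" "0 < e"
  show "\<exists>C. A \<subseteq> (\<Union>i. C i) \<and>
      (\<forall>i. bounded (C i) \<and> diameter (C i) \<le> \<delta>) \<and> (\<Sum>i. hausdorff_weight s (C i)) \<le> ennreal e"
  proof (intro exI[of _ "\<lambda>i. {from_nat_into A i}"] conjI allI)
    show "A \<subseteq> (\<Union>i. {from_nat_into A i})"
      using from_nat_into_surj[OF assms(1)] by fastforce
  qed (use \<open>0 < \<delta>\<close> assms(2) in \<open>auto simp: hausdorff_weight_pos\<close>)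
qed

text \<open>
  A nonempty set has weight 1 for the exponent 0, so a cover of total weight less than 1 has only
  empty members.
\<close>
lemma hausdorff_nonnull_0: "A \<noteq> {} \<Longrightarrow> hausdorff_measure 0 A \<noteq> 0"
proof
  assume "A \<noteq> {}" "hausdorff_measure 0 A = 0"
  then obtain C where C: "A \<subseteq> (\<Union>i. C i)" "(\<Sum>i. hausdorff_weight 0 (C i)) < ennreal 1"
    using hausdorff_null_cover[of 0 A 1 1] by (metis zero_less_one)
  have "C i = {}" for i
  proof (rule ccontr)
    assume "C i \<noteq> {}"
    hence "1 \<le> (\<Sum>i\<in>{i}. hausdorff_weight 0 (C i))" by (simp add: hausdorff_weight_def)
    also have "\<dots> \<le> (\<Sum>i. hausdorff_weight 0 (C i))" by (intro sum_le_suminf) auto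
    finally show False using C(2) by simp
  qed
  thus False using C(1) \<open>A \<noteq> {}\<close> by auto
qed

lemma hausdorff_dim_eqI:
  assumes "0 \<le> D"
    and "\<And>s. D < s \<Longrightarrow> hausdorff_measure s A = 0"
    and "\<And>s. 0 \<le> s \<Longrightarrow> hausdorff_measure s A = 0 \<Longrightarrow> D \<le> s"
  shows "hausdorff_dim A = ereal D"
  unfolding hausdorff_dim_def
proof (rule antisym)
  show "(INF s\<in>{s. 0 \<le> s \<and> hausdorff_measure s A = 0}. ereal s) \<le> ereal D"
  proof (rule ereal_le_epsilon2)
    fix e :: real assume "0 < e"
    thus "(INF s\<in>{s. 0 \<le> s \<and> hausdorff_measure s A = 0}. ereal s) \<le> ereal D + ereal e"
      using assms(1,2) by (intro INF_lower2[of "D + e"]) auto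
  qed
  show "ereal D \<le> (INF s\<in>{s. 0 \<le> s \<and> hausdorff_measure s A = 0}. ereal s)"
    using assms(3) by (intro INF_greatest) auto
qed

section \<open>Infinite trees of binary words\<close>

text \<open>Koenig's lemma: always step to a child that has infinitely many descendants in the tree.\<close>
lemma koenig_binary:
  fixes B :: "bool list set"
  assumes inf: "infinite B" and prefix: "\<And>u v. u @ v \<in> B \<Longrightarrow> u \<in> B"
  shows "\<exists>e. \<forall>n. map e [0..<n] \<in> B"
proof -
  define big where "big u \<longleftrightarrow> infinite {v. u @ v \<in> B}" for u
  have step: "\<exists>d. big (u @ [d])" if "big u" for u
  proof (rule ccontr)
    assume "\<nexists>d. big (u @ [d])"
    hence "finite (insert [] (\<Union>d. Cons d ` {v. (u @ [d]) @ v \<in> B}))"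
      by (auto simp: big_def)
    moreover have "{v. u @ v \<in> B} \<subseteq> insert [] (\<Union>d. Cons d ` {v. (u @ [d]) @ v \<in> B})"
    proof
      fix v assume "v \<in> {v. u @ v \<in> B}"
      thus "v \<in> insert [] (\<Union>d. Cons d ` {v. (u @ [d]) @ v \<in> B})" by (cases v) auto
    qed
    ultimately show False using that finite_subset unfolding big_def by blast
  qed
  define U where "U = rec_nat [] (\<lambda>_ u. u @ [SOME d. big (u @ [d])])"
  define e where "e n = (SOME d. big (U n @ [d]))" for n
  have U: "U n = map e [0..<n]" for n
    by (induction n) (auto simp: U_def e_def)
  have "big (U n)" for n
  proof (induction n)
    case 0
    show ?case using inf by (simp add: U_def big_def)
  next
    case (Suc n)
    show ?case using someI_ex[OF step[OF Suc]] by (simp add: U_def)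
  qed
  hence "\<exists>v. U n @ v \<in> B" for n
    unfolding big_def by (metis (mono_tags, lifting) empty_Collect_eq finite.emptyI)
  thus ?thesis using prefix U by metis
qed

text \<open>
  Bounds a sum over a finite set of values of \<open>W\<close> in which no value is repeated, while
  \<open>W\<close> itself may take a value many times.
\<close>
lemma sum_le_suminf_of_range:
  fixes h :: "'b \<Rightarrow> real" and W :: "nat \<Rightarrow> 'b"
  assumes "finite F" "F \<subseteq> range W" "\<And>w. 0 \<le> h w" "summable (\<lambda>i. h (W i))"
  shows "sum h F \<le> (\<Sum>i. h (W i))"
proof -
  obtain I where I: "inj_on W I" "F = W ` I" using assms(2) subset_image_inj[of F W UNIV] by blast
  have "finite I" using I assms(1) finite_image_iff by blast
  have "sum h F = (\<Sum>i\<in>I. h (W i))" using I by (simp add: sum.reindex)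
  also have "\<dots> \<le> (\<Sum>i. h (W i))" using assms \<open>finite I\<close> by (intro sum_le_suminf) auto
  finally show ?thesis .
qed

section \<open>Cylinders of the map that avoids the hole\<close>

locale expansion_base =
  fixes \<beta> :: real
  assumes base_gt_1: "1 < \<beta>" and base_le_2: "\<beta> \<le> 2"
begin

text \<open>
  The two components of the complement of the hole, closed up by the endpoints of the hole so that
  cylinders are compact.
\<close>
fun branch :: "bool \<Rightarrow> real set" where
  "branch False = {0 .. 1 / \<beta>}"
| "branch True = {1 / (\<beta> * (\<beta> - 1)) .. 1 / (\<beta> - 1)}"

fun cyl :: "bool list \<Rightarrow> real set" where
  "cyl [] = {0 .. 1 / (\<beta> - 1)}"
| "cyl (d # w) = {x \<in> branch d. \<beta> * x - of_bool d \<in> cyl w}"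

fun walk :: "bool list \<Rightarrow> real \<Rightarrow> real" where
  "walk [] x = x"
| "walk (d # w) x = walk w (\<beta> * x - of_bool d)"

definition hole_length :: real where
  "hole_length = 1 / (\<beta> * (\<beta> - 1)) - 1 / \<beta>"

text \<open>
  The words \<open>w\<close> range over all binary words, not only over those that the point follows; this keeps
  the set countable, and no step out of its complement can enter it.
\<close>
definition boundary_hitting :: "real set" where
  "boundary_hitting = {x. \<exists>w. walk w x \<in> {1 / \<beta>, 1 / (\<beta> * (\<beta> - 1))}}"

definition words :: "nat \<Rightarrow> bool list set" where
  "words n = {w. length w = n \<and> cyl w \<noteq> {}}"

definition itinerary :: "(nat \<Rightarrow> bool) \<Rightarrow> real \<Rightarrow> bool" where
  "itinerary e x \<longleftrightarrow> (\<forall>n. x \<in> cyl (map e [0..<n]))"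

lemma basic_ineqs:
  shows "0 < \<beta>" "0 < \<beta> - 1" "0 < 1 / \<beta>" "1 / \<beta> < 1" "1 / \<beta> \<le> 1 / (\<beta> * (\<beta> - 1))"
    "1 / (\<beta> * (\<beta> - 1)) < 1 / (\<beta> - 1)" "1 \<le> 1 / (\<beta> - 1)"
proof -
  show b: "0 < \<beta>" "0 < \<beta> - 1" using base_gt_1 by auto
  show "0 < 1 / \<beta>" "1 / \<beta> < 1" "1 \<le> 1 / (\<beta> - 1)" using base_gt_1 base_le_2 by auto
  have "1 * (\<beta> - 1) < \<beta> * (\<beta> - 1)" "\<beta> * (\<beta> - 1) \<le> \<beta> * 1"
    using base_gt_1 base_le_2 by (intro mult_strict_right_mono mult_left_mono; simp)+
  thus "1 / \<beta> \<le> 1 / (\<beta> * (\<beta> - 1))" "1 / (\<beta> * (\<beta> - 1)) < 1 / (\<beta> - 1)"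
    using b by (intro divide_left_mono divide_strict_left_mono; simp)+
qed

lemma hole_length_nonneg: "0 \<le> hole_length"
  using basic_ineqs by (simp add: hole_length_def)

lemma hole_length_pos: "\<beta> < 2 \<Longrightarrow> 0 < hole_length"
  using base_gt_1 by (simp add: hole_length_def field_simps)

lemma branch_subset: "branch d \<subseteq> {0 .. 1 / (\<beta> - 1)}"
  using basic_ineqs by (cases d) auto

lemma cyl_subset: "cyl w \<subseteq> {0 .. 1 / (\<beta> - 1)}"
  using branch_subset by (cases w) (force, fastforce)

lemma walk_append: "walk (u @ v) x = walk v (walk u x)"
  by (induction u arbitrary: x) auto

text \<open>Every digit step is affine with slope \<open>\<beta>\<close>.\<close>
lemma walk_diff: "walk w x - walk w y = \<beta> ^ length w * (x - y)"
proof (induction w arbitrary: x y)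
  case (Cons d w)
  show ?case using Cons[of "\<beta> * x - of_bool d" "\<beta> * y - of_bool d"]
    by (simp add: algebra_simps del: of_bool_eq)
qed simp

lemma walk_le_iff: "walk w x \<le> walk w y \<longleftrightarrow> x \<le> y"
proof -
  have p: "0 < \<beta> ^ length w" using basic_ineqs(1) by simp
  have "walk w x \<le> walk w y \<longleftrightarrow> \<beta> ^ length w * (x - y) \<le> \<beta> ^ length w * 0"
    using walk_diff[of w x y] by auto
  also have "\<dots> \<longleftrightarrow> x - y \<le> 0" by (rule mult_le_cancel_left_pos[OF p])
  finally show ?thesis by simp
qed

lemma cyl_append: "x \<in> cyl (u @ v) \<longleftrightarrow> x \<in> cyl u \<and> walk u x \<in> cyl v"
  using cyl_subset[of v] by (induction u arbitrary: x) auto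

lemma walk_in_range: "x \<in> cyl w \<Longrightarrow> walk w x \<in> {0 .. 1 / (\<beta> - 1)}"
  using cyl_append[of x w "[]"] by simp

lemma cyl_convex:
  assumes "x \<in> cyl w" "y \<in> cyl w" "x \<le> z" "z \<le> y"
  shows "z \<in> cyl w"
  using assms
proof (induction w arbitrary: x y z)
  case (Cons d w)
  have "z \<in> branch d"
    using Cons.prems by (cases d) auto
  moreover have "\<beta> * x - of_bool d \<le> \<beta> * z - of_bool d" "\<beta> * z - of_bool d \<le> \<beta> * y - of_bool d"
    using Cons.prems basic_ineqs(1) by auto
  ultimately show ?case
    using Cons.IH[of "\<beta> * x - of_bool d" "\<beta> * y - of_bool d" "\<beta> * z - of_bool d"] Cons.prems
    by auto
qed auto

lemma cyl_closed: "closed (cyl w)"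
proof (induction w)
  case (Cons d w)
  have "closed (branch d)" by (cases d) auto
  moreover have "closed ((\<lambda>x. \<beta> * x - of_bool d) -` cyl w)"
    by (rule closed_vimage[OF Cons]) (intro continuous_intros)
  moreover have "cyl (d # w) = branch d \<inter> (\<lambda>x. \<beta> * x - of_bool d) -` cyl w"
    by auto
  ultimately show ?case by (metis closed_Int)
qed auto

lemma cyl_compact: "compact (cyl w)"
  by (meson bounded_closed_interval bounded_subset compact_eq_bounded_closed cyl_closed cyl_subset)

lemma cyl_dist:
  assumes "x \<in> cyl w" "y \<in> cyl w"
  shows "\<bar>x - y\<bar> \<le> (1 / (\<beta> - 1)) / \<beta> ^ length w"
proof -
  have "\<bar>walk w x - walk w y\<bar> \<le> 1 / (\<beta> - 1)"
    using walk_in_range[OF assms(1)] walk_in_range[OF assms(2)] by auto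
  hence "\<beta> ^ length w * \<bar>x - y\<bar> \<le> 1 / (\<beta> - 1)"
    using basic_ineqs(1) by (simp add: walk_diff abs_mult)
  moreover have "0 < \<beta> ^ length w" using basic_ineqs(1) by simp
  ultimately show ?thesis by (metis mult.commute pos_le_divide_eq)
qed

text \<open>
  At the first digit where the words differ, the two orbits are on opposite sides of the hole.
  Until then each step multiplies their distance by \<open>\<beta>\<close>.
\<close>
lemma cyl_separated:
  assumes "length u = length v" "u \<noteq> v" "x \<in> cyl u" "y \<in> cyl v"
  shows "hole_length \<le> \<beta> ^ length u * \<bar>x - y\<bar>"
  using assms
proof (induction u v arbitrary: x y rule: list_induct2)
  case (Cons d u d' v)
  show ?case
  proof (cases "d = d'")
    case True
    have "hole_length \<le> \<beta> ^ length u * \<bar>(\<beta> * x - of_bool d) - (\<beta> * y - of_bool d)\<bar>"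
      using True Cons.prems by (intro Cons.IH) auto
    also have "(\<beta> * x - of_bool d) - (\<beta> * y - of_bool d) = \<beta> * (x - y)"
      by (simp add: algebra_simps)
    finally show ?thesis using basic_ineqs(1) by (simp add: abs_mult mult.left_commute)
  next
    case False
    have "hole_length \<le> \<bar>x - y\<bar>"
      using Cons.prems False by (cases d; cases d') (auto simp: hole_length_def)
    moreover have "1 \<le> \<beta> ^ length (d # u)"
      using base_gt_1 by (intro one_le_power) simp
    ultimately show ?thesis
      using mult_right_mono[of 1 "\<beta> ^ length (d # u)" "\<bar>x - y\<bar>"] by simp
  qed
qed auto

lemma finite_words: "finite (words n)"
proof -
  have "words n \<subseteq> {w. set w \<subseteq> UNIV \<and> length w = n}" by (auto simp: words_def)
  thus ?thesis by (rule finite_subset) (intro finite_lists_length_eq finite)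
qed

lemma card_words_le: "card (words n) \<le> 2 ^ n"
proof -
  have "words n \<subseteq> {w. set w \<subseteq> UNIV \<and> length w = n}" by (auto simp: words_def)
  hence "card (words n) \<le> card {w::bool list. set w \<subseteq> UNIV \<and> length w = n}"
    by (rule card_mono[OF finite_lists_length_eq[OF finite]])
  also have "\<dots> = 2 ^ n" by (subst card_lists_length_eq) auto
  finally show ?thesis .
qed

lemma zero_in_cyl: "0 \<in> cyl (replicate n False)"
  using basic_ineqs by (induction n) auto

lemma card_words_pos: "1 \<le> card (words n)"
proof -
  have "replicate n False \<in> words n" using zero_in_cyl by (auto simp: words_def)
  hence "0 < card (words n)" using finite_words[of n] card_gt_0_iff by blast
  thus ?thesis by simp
qed

lemma words_append: "u @ v \<in> words (length u + n) \<Longrightarrow> u \<in> words (length u) \<and> v \<in> words n"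
  by (auto simp: words_def cyl_append)

lemma card_words_add: "card (words (m + n)) \<le> card (words m) * card (words n)"
proof -
  have "words (m + n) \<subseteq> (\<lambda>(u, v). u @ v) ` (words m \<times> words n)"
  proof
    fix w assume w: "w \<in> words (m + n)"
    have l: "length (take m w) = m" using w by (auto simp: words_def)
    have "take m w \<in> words m \<and> drop m w \<in> words n"
      using words_append[of "take m w" "drop m w" n] w l by simp
    thus "w \<in> (\<lambda>(u, v). u @ v) ` (words m \<times> words n)"
      by (intro image_eqI[of _ _ "(take m w, drop m w)"]) auto
  qed
  hence "card (words (m + n)) \<le> card ((\<lambda>(u, v). u @ v) ` (words m \<times> words n))"
    by (intro card_mono finite_imageI finite_cartesian_product finite_words)
  also have "\<dots> \<le> card (words m \<times> words n)"
    by (intro card_image_le finite_cartesian_product finite_words)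
  finally show ?thesis by (simp add: card_cartesian_product)
qed

text \<open>For each word the walk is injective, so it takes each endpoint value at most once.\<close>
lemma countable_boundary_hitting: "countable boundary_hitting"
proof -
  have "finite {x. walk w x = c}" for w c
  proof (cases "\<exists>y. walk w y = c")
    case True
    then obtain y where y: "walk w y = c" by blast
    have "x = y" if "walk w x = c" for x
      using walk_diff[of w x y] y that basic_ineqs(1) by auto
    hence "{x. walk w x = c} \<subseteq> {y}" by auto
    thus ?thesis by (meson finite.emptyI finite_insert finite_subset)
  qed auto
  hence "countable ({x. walk w x = 1 / \<beta>} \<union> {x. walk w x = 1 / (\<beta> * (\<beta> - 1))})" for w
    by (simp add: countable_finite)
  hence "countable (\<Union>w. {x. walk w x = 1 / \<beta>} \<union> {x. walk w x = 1 / (\<beta> * (\<beta> - 1))})"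
    by (intro countable_UN) auto
  moreover have "boundary_hitting = (\<Union>w. {x. walk w x = 1 / \<beta>} \<union> {x. walk w x = 1 / (\<beta> * (\<beta> - 1))})"
    by (auto simp: boundary_hitting_def)
  ultimately show ?thesis by simp
qed

lemma boundary_hitting_step: "x \<notin> boundary_hitting \<Longrightarrow> walk w x \<notin> boundary_hitting"
  by (auto simp: boundary_hitting_def simp flip: walk_append)

lemma itinerary_step:
  assumes "itinerary e x"
  shows "x \<in> branch (e 0)" "itinerary (\<lambda>n. e (Suc n)) (\<beta> * x - of_bool (e 0))"
proof -
  have *: "x \<in> cyl (e 0 # map (\<lambda>i. e (Suc i)) [0..<n])" for n
    using assms unfolding itinerary_def map_upt_Suc[symmetric] by blast
  show "x \<in> branch (e 0)" using *[of 0] by simp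
  show "itinerary (\<lambda>n. e (Suc n)) (\<beta> * x - of_bool (e 0))"
    unfolding itinerary_def using * by auto
qed

section \<open>Expansions and the univoque set\<close>

text \<open>
  Deleting the first digit of an expansion of \<open>x\<close> gives an expansion of \<open>\<beta> x\<close> minus that digit, so
  expansions can be handled digit by digit.
\<close>
lemma beta_expansion_step:
  "beta_expansion \<beta> x \<epsilon> \<longleftrightarrow>
     \<epsilon> 0 \<in> {0, 1} \<and> beta_expansion \<beta> (\<beta> * x - real (\<epsilon> 0)) (\<lambda>n. \<epsilon> (Suc n))"
proof -
  have r: "range \<epsilon> = insert (\<epsilon> 0) (range (\<lambda>n. \<epsilon> (Suc n)))"
    by (auto intro: nat.exhaust) (metis not0_implies_Suc rangeI)
  have "((\<lambda>n. real (\<epsilon> n) / \<beta> ^ Suc n) sums x) \<longleftrightarrow>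
      ((\<lambda>n. real (\<epsilon> (Suc n)) / \<beta> ^ Suc (Suc n)) sums (x - real (\<epsilon> 0) / \<beta>))"
    using sums_Suc_iff[of "\<lambda>n. real (\<epsilon> n) / \<beta> ^ Suc n" "x - real (\<epsilon> 0) / \<beta>"] by simp
  also have "\<dots> \<longleftrightarrow> ((\<lambda>n. \<beta> * (real (\<epsilon> (Suc n)) / \<beta> ^ Suc (Suc n))) sums (\<beta> * (x - real (\<epsilon> 0) / \<beta>)))"
    using basic_ineqs(1) by (intro sums_mult_iff[symmetric]) auto
  also have "(\<lambda>n. \<beta> * (real (\<epsilon> (Suc n)) / \<beta> ^ Suc (Suc n))) = (\<lambda>n. real (\<epsilon> (Suc n)) / \<beta> ^ Suc n)"
    using basic_ineqs(1) by (auto simp: field_simps)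
  also have "\<beta> * (x - real (\<epsilon> 0) / \<beta>) = \<beta> * x - real (\<epsilon> 0)"
    using basic_ineqs(1) by (auto simp: field_simps)
  finally show ?thesis unfolding beta_expansion_def r by auto
qed

lemma beta_expansion_range:
  assumes "beta_expansion \<beta> x \<epsilon>"
  shows "x \<in> {0 .. 1 / (\<beta> - 1)}"
proof -
  have s: "(\<lambda>n. real (\<epsilon> n) / \<beta> ^ Suc n) sums x" and r: "\<And>n. \<epsilon> n \<in> {0, 1}"
    using assms by (auto simp: beta_expansion_def)
  have "(\<lambda>n. (1 / \<beta>) * (1 / \<beta>) ^ n) sums ((1 / \<beta>) * (1 / (1 - 1 / \<beta>)))"
    using basic_ineqs by (intro sums_mult geometric_sums) auto
  also have "(1 / \<beta>) * (1 / (1 - 1 / \<beta>)) = 1 / (\<beta> - 1)"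
    using basic_ineqs by (simp add: field_simps)
  finally have g: "(\<lambda>n. 1 / \<beta> ^ Suc n) sums (1 / (\<beta> - 1))"
    by (simp add: power_one_over)
  have b: "real (\<epsilon> n) \<le> 1" for n using r[of n] by auto
  have "0 \<le> x" by (rule sums_le[OF _ sums_zero s]) (use basic_ineqs in simp)
  moreover have "x \<le> 1 / (\<beta> - 1)"
    by (rule sums_le[OF _ s g]) (use b basic_ineqs in \<open>simp add: divide_right_mono\<close>)
  ultimately show ?thesis by simp
qed

text \<open>
  A choice of digits expands \<open>x\<close> as soon as the remainders stay in the interval: after \<open>n\<close> digits
  the error is the remainder divided by \<open>\<beta> ^ n\<close>.
\<close>
lemma beta_expansionI:
  assumes "\<And>n. \<epsilon> n \<in> {0, 1}" and "\<And>n. y (Suc n) = \<beta> * y n - real (\<epsilon> n)"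
    and "\<And>n. y n \<in> {0 .. 1 / (\<beta> - 1)}"
  shows "beta_expansion \<beta> (y 0) \<epsilon>"
proof -
  have part: "(\<Sum>k<n. real (\<epsilon> k) / \<beta> ^ Suc k) = y 0 - y n / \<beta> ^ n" for n
  proof (induction n)
    case (Suc n)
    have "y n / \<beta> ^ n = \<beta> * y n / \<beta> ^ Suc n" using basic_ineqs(1) by simp
    thus ?case unfolding sum.lessThan_Suc Suc.IH assms(2) by (simp add: diff_divide_distrib)
  qed simp
  have "(\<lambda>n. (1 / (\<beta> - 1)) * (1 / \<beta>) ^ n) \<longlonglongrightarrow> (1 / (\<beta> - 1)) * 0"
    using basic_ineqs by (intro tendsto_mult tendsto_const LIMSEQ_realpow_zero) auto
  hence "(\<lambda>n. y n / \<beta> ^ n) \<longlonglongrightarrow> 0"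
  proof (intro tendsto_sandwich[of "\<lambda>_. 0" "\<lambda>n. y n / \<beta> ^ n" _ "\<lambda>n. (1 / (\<beta> - 1)) * (1 / \<beta>) ^ n"] always_eventually allI)
    show "0 \<le> y n / \<beta> ^ n" for n using assms(3)[of n] basic_ineqs by simp
    show "y n / \<beta> ^ n \<le> 1 / (\<beta> - 1) * (1 / \<beta>) ^ n" for n
      using assms(3)[of n] basic_ineqs divide_right_mono[of "y n" "1 / (\<beta> - 1)" "\<beta> ^ n"]
      by (simp add: power_one_over)
  qed auto
  hence "(\<lambda>n. y 0 - y n / \<beta> ^ n) \<longlonglongrightarrow> y 0 - 0" by (intro tendsto_diff tendsto_const)
  hence "(\<lambda>k. real (\<epsilon> k) / \<beta> ^ Suc k) sums y 0"
    unfolding sums_def part by simp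
  moreover have "range \<epsilon> \<subseteq> {0, 1}" using assms(1) by (rule image_subsetI)
  ultimately show ?thesis unfolding beta_expansion_def by blast
qed

lemma upper_branch_image: "x \<le> 1 / (\<beta> - 1) \<Longrightarrow> \<beta> * x - 1 \<le> 1 / (\<beta> - 1)"
proof -
  assume "x \<le> 1 / (\<beta> - 1)"
  hence "\<beta> * x \<le> \<beta> * (1 / (\<beta> - 1))" using basic_ineqs(1) by (intro mult_left_mono) auto
  also have "\<dots> = 1 + 1 / (\<beta> - 1)" using basic_ineqs(2) by (simp add: field_simps)
  finally show ?thesis by simp
qed

lemma greedy_map_range:
  "x \<in> {0 .. 1 / (\<beta> - 1)} \<Longrightarrow> greedy_map \<beta> x \<in> {0 .. 1 / (\<beta> - 1)}"
proof -
  assume x: "x \<in> {0 .. 1 / (\<beta> - 1)}"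
  have 1: "\<beta> * x - 1 \<le> 1 / (\<beta> - 1)" using x upper_branch_image by simp
  have 2: "x < 1 / \<beta> \<longleftrightarrow> \<beta> * x < 1" using basic_ineqs(1) by (simp add: field_simps)
  show ?thesis using 1 x basic_ineqs(1,7) by (auto simp: greedy_map_def 2)
qed

lemma beta_expansion_exists:
  assumes "x \<in> {0 .. 1 / (\<beta> - 1)}"
  obtains \<epsilon> where "beta_expansion \<beta> x \<epsilon>"
proof -
  define y where "y = (\<lambda>n. (greedy_map \<beta> ^^ n) x)"
  define \<epsilon> :: "nat \<Rightarrow> nat" where "\<epsilon> = (\<lambda>n. if y n < 1 / \<beta> then 0 else 1)"
  have "beta_expansion \<beta> (y 0) \<epsilon>"
  proof (rule beta_expansionI)
    show "y n \<in> {0 .. 1 / (\<beta> - 1)}" for n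
      by (induction n) (use assms greedy_map_range in \<open>auto simp: y_def\<close>)
  qed (auto simp: \<epsilon>_def y_def greedy_map_def)
  thus ?thesis using that by (simp add: y_def)
qed

text \<open>
  If both digits led back into the interval, each could be completed to an expansion. Hence a
  univoque point is outside the hole, and its image is again univoque.
\<close>
lemma univoque_step:
  assumes "x \<in> univoque_set \<beta>"
  shows "\<exists>d. x \<in> branch d \<and> \<beta> * x - of_bool d \<in> univoque_set \<beta>"
proof -
  obtain \<epsilon> where \<epsilon>: "beta_expansion \<beta> x \<epsilon>" and uniq: "\<And>\<eta>. beta_expansion \<beta> x \<eta> \<Longrightarrow> \<eta> = \<epsilon>"
    and x: "x \<in> {0 .. 1 / (\<beta> - 1)}"
    using assms by (auto simp: univoque_set_def)
  have cons: "beta_expansion \<beta> x (case_nat c \<eta>)"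
    if "beta_expansion \<beta> (\<beta> * x - real c) \<eta>" "c \<in> {0, 1}" for c \<eta>
    using that by (subst beta_expansion_step) auto
  have digit: "\<epsilon> 0 = c" if c: "\<beta> * x - real c \<in> {0 .. 1 / (\<beta> - 1)}" "c \<in> {0, 1}" for c
  proof -
    obtain \<eta> where "beta_expansion \<beta> (\<beta> * x - real c) \<eta>"
      using beta_expansion_exists[OF c(1)] by blast
    hence "case_nat c \<eta> = \<epsilon>" using cons c(2) uniq by blast
    thus ?thesis by (metis old.nat.simps(4))
  qed
  define d where "d = (\<epsilon> 0 = 1)"
  have \<epsilon>0: "\<epsilon> 0 \<in> {0, 1}" and tail: "beta_expansion \<beta> (\<beta> * x - real (\<epsilon> 0)) (\<lambda>n. \<epsilon> (Suc n))"
    using \<epsilon> beta_expansion_step by blast+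
  have d: "real (\<epsilon> 0) = of_bool d" using \<epsilon>0 by (auto simp: d_def)
  have "x \<in> branch d"
  proof (cases d)
    case True
    hence "\<not> (\<beta> * x - real 0 \<in> {0 .. 1 / (\<beta> - 1)})" using digit[of 0] by (auto simp: d_def)
    hence "\<beta> * x > 1 / (\<beta> - 1)" using x basic_ineqs(1) by auto
    hence "1 / (\<beta> * (\<beta> - 1)) < x" using basic_ineqs by (simp add: field_simps)
    thus ?thesis using True x by auto
  next
    case False
    hence "\<not> (\<beta> * x - real 1 \<in> {0 .. 1 / (\<beta> - 1)})" using digit[of 1] \<epsilon>0 by (auto simp: d_def)
    moreover have "\<beta> * x - real 1 \<le> 1 / (\<beta> - 1)" using x upper_branch_image by simp
    ultimately have "\<beta> * x < 1" by auto
    hence "x < 1 / \<beta>" using basic_ineqs by (simp add: field_simps)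
    thus ?thesis using False x by auto
  qed
  moreover have "\<beta> * x - of_bool d \<in> univoque_set \<beta>"
  proof -
    have "\<eta> = (\<lambda>n. \<epsilon> (Suc n))" if "beta_expansion \<beta> (\<beta> * x - real (\<epsilon> 0)) \<eta>" for \<eta>
    proof -
      have "case_nat (\<epsilon> 0) \<eta> = \<epsilon>" using cons[OF that \<epsilon>0] uniq by blast
      thus ?thesis by (metis old.nat.simps(5))
    qed
    thus ?thesis using tail beta_expansion_range[OF tail] unfolding d[symmetric] univoque_set_def
      by blast
  qed
  ultimately show ?thesis by blast
qed

lemma univoque_in_cyl:
  "x \<in> univoque_set \<beta> \<Longrightarrow> \<exists>w \<in> words n. x \<in> cyl w"
proof (induction n arbitrary: x)
  case 0
  hence "x \<in> cyl []" by (simp add: univoque_set_def)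
  thus ?case unfolding words_def by blast
next
  case (Suc n)
  obtain d where d: "x \<in> branch d" "\<beta> * x - of_bool d \<in> univoque_set \<beta>"
    using univoque_step[OF Suc.prems] by blast
  obtain w where "w \<in> words n" "\<beta> * x - of_bool d \<in> cyl w" using Suc.IH[OF d(2)] by blast
  thus ?case using d(1) by (intro bexI[of _ "d # w"]) (auto simp: words_def)
qed

text \<open>
  A point of a branch that is not an endpoint of the hole lies outside the hole, so the other digit
  would leave the interval.
\<close>
lemma digit_forced:
  assumes "beta_expansion \<beta> x \<epsilon>" "x \<in> branch d" "x \<notin> boundary_hitting"
  shows "\<epsilon> 0 = of_bool d"
proof -
  have \<epsilon>: "\<epsilon> 0 \<in> {0, 1}" "\<beta> * x - real (\<epsilon> 0) \<in> {0 .. 1 / (\<beta> - 1)}"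
    using assms(1) beta_expansion_step beta_expansion_range by blast+
  have "walk [] x \<notin> {1 / \<beta>, 1 / (\<beta> * (\<beta> - 1))}"
    using assms(3) unfolding boundary_hitting_def by blast
  thus ?thesis using \<epsilon> assms(2) basic_ineqs(1,2)
    by (cases d) (auto simp: field_simps)
qed

text \<open>
  Conversely to \<open>univoque_in_cyl\<close>, closing up the cylinders adds only points of the countable set
  \<open>boundary_hitting\<close> to the univoque set.
\<close>
lemma itinerary_univoque:
  assumes "itinerary e x" "x \<notin> boundary_hitting"
  shows "x \<in> univoque_set \<beta>"
proof -
  have x: "x \<in> {0 .. 1 / (\<beta> - 1)}" using assms(1) cyl_subset unfolding itinerary_def by blast
  have "beta_expansion \<beta> (walk (map e [0..<0]) x) (\<lambda>n. of_bool (e n))"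
  proof (rule beta_expansionI[where y = "\<lambda>n. walk (map e [0..<n]) x"])
    show "walk (map e [0..<n]) x \<in> {0 .. 1 / (\<beta> - 1)}" for n
      using assms(1) walk_in_range unfolding itinerary_def by blast
  qed (auto simp: walk_append)
  hence ex: "beta_expansion \<beta> x (\<lambda>n. of_bool (e n))" by simp
  have "\<epsilon> n = of_bool (e n)" if "beta_expansion \<beta> x \<epsilon>" for \<epsilon> n
    using assms that
  proof (induction n arbitrary: x e \<epsilon>)
    case 0
    show ?case using digit_forced[OF 0(3) itinerary_step(1)[OF 0(1)] 0(2)] .
  next
    case (Suc n)
    have "\<epsilon> 0 = of_bool (e 0)"
      using digit_forced[OF Suc.prems(3) itinerary_step(1)[OF Suc.prems(1)] Suc.prems(2)] .
    hence "beta_expansion \<beta> (\<beta> * x - of_bool (e 0)) (\<lambda>n. \<epsilon> (Suc n))"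
      using Suc.prems(3) beta_expansion_step[of x \<epsilon>] by simp
    moreover have "\<beta> * x - of_bool (e 0) \<notin> boundary_hitting"
      using boundary_hitting_step[OF Suc.prems(2), of "[e 0]"] by simp
    ultimately show ?case
      using Suc.IH[of "\<lambda>n. e (Suc n)"] itinerary_step(2)[OF Suc.prems(1)] by blast
  qed
  hence "\<epsilon> = (\<lambda>n. of_bool (e n))" if "beta_expansion \<beta> x \<epsilon>" for \<epsilon> using that by blast
  thus ?thesis using x ex unfolding univoque_set_def by blast
qed

section \<open>Exponential growth from null Hausdorff measure\<close>

text \<open>The cylinders of the prefixes are nested nonempty compact sets.\<close>
lemma words_itinerary:
  assumes "\<And>n. map e [0..<n] \<in> words n"
  shows "\<exists>x. itinerary e x"
proof -
  have "\<Inter> (range (\<lambda>n. cyl (map e [0..<n]))) \<noteq> {}"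
  proof (rule compact_nest)
    fix m n :: nat assume "m \<le> n"
    hence "map e [0..<n] = map e [0..<m] @ map e [m..<n]"
      by (metis le0 le_add_diff_inverse map_append upt_add_eq_append)
    thus "cyl (map e [0..<n]) \<subseteq> cyl (map e [0..<m])" using cyl_append by auto
  qed (use assms cyl_compact in \<open>auto simp: words_def\<close>)
  thus ?thesis unfolding itinerary_def by blast
qed

lemma inverse_power_powr: "inverse (\<beta> ^ m) powr s = (\<beta> powr - s) ^ m"
proof -
  have "inverse (\<beta> ^ m) = \<beta> powr (- real m)"
    using basic_ineqs(1) by (simp add: powr_minus powr_realpow)
  moreover have "(\<beta> powr - s) ^ m = \<beta> powr (- s * real m)"
    using basic_ineqs(1) by (simp add: powr_realpow[symmetric] powr_powr)
  ultimately show ?thesis by (simp add: powr_powr mult.commute)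
qed

text \<open>
  Chooses the word length \<open>m\<close> at which to read a set of diameter \<open>d\<close>: short enough that the set meets
  only one cylinder, and long enough that the weight of the word is at most of order \<open>d powr s\<close>.
  The summand \<open>\<eta>\<close> is there for \<open>d = 0\<close>, where \<open>m\<close> can be arbitrarily large.
\<close>
lemma scale_choice:
  assumes "\<beta> < 2" "0 < s" "0 \<le> d" "d < hole_length" "0 < \<eta>"
  shows "\<exists>m. d < hole_length / \<beta> ^ m \<and> (\<beta> powr - s) ^ m \<le> (\<beta> / hole_length) powr s * d powr s + \<eta>"
proof -
  note gap = hole_length_pos[OF assms(1)]
  have "\<beta> powr - s < 1" using assms base_gt_1 by (simp add: powr_less_one)
  then obtain N where N: "(\<beta> powr - s) ^ N < \<eta>"
    using real_arch_pow_inv assms(5) by blast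
  show ?thesis
  proof (cases "d < hole_length / \<beta> ^ N")
    case True
    thus ?thesis using N gap by (intro exI[of _ N]) (simp add: add_increasing)
  next
    case False
    \<comment> \<open>The last \<open>m\<close> with \<open>d < hole_length / \<beta> ^ m\<close> is determined up to the factor \<open>\<beta>\<close> by \<open>d\<close>.\<close>
    define k where "k = (LEAST k. \<not> d < hole_length / \<beta> ^ k)"
    have k: "\<not> d < hole_length / \<beta> ^ k" unfolding k_def by (rule LeastI[of _ N]) (use False in simp)
    hence "k \<noteq> 0" using assms(4) by (cases k) auto
    then obtain m where m: "k = Suc m" using not0_implies_Suc by blast
    have 1: "d < hole_length / \<beta> ^ m" using not_less_Least[of m "\<lambda>k. \<not> d < hole_length / \<beta> ^ k"] m k_def by auto
    have p: "0 < \<beta> ^ m" using basic_ineqs(1) by simp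
    have "hole_length / (\<beta> * \<beta> ^ m) \<le> d" using k m by simp
    hence "inverse (\<beta> ^ m) \<le> \<beta> / hole_length * d"
      using gap p basic_ineqs(1) by (simp add: field_simps)
    hence "inverse (\<beta> ^ m) powr s \<le> (\<beta> / hole_length * d) powr s"
      using p assms(2) by (intro powr_mono2) auto
    also have "\<dots> = (\<beta> / hole_length) powr s * d powr s"
      using gap basic_ineqs(1) assms(3) by (intro powr_mult)
    finally show ?thesis unfolding inverse_power_powr using 1 assms(5) by (intro exI[of _ m]) auto
  qed
qed

text \<open>
  A set of diameter less than \<open>hole_length / \<beta> ^ m\<close> meets at most one cylinder of length \<open>m\<close>, by
  separation. So each member of a cover can be replaced by one word.
\<close>
lemma covering_words:
  assumes "\<beta> < 2" "0 < s" "hausdorff_measure s A = 0" "0 < \<epsilon>"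
  shows "\<exists>W :: nat \<Rightarrow> bool list. (\<forall>x\<in>A. \<forall>e. itinerary e x \<longrightarrow> (\<exists>i n. W i = map e [0..<n])) \<and>
    summable (\<lambda>i. (\<beta> powr - s) ^ length (W i)) \<and> (\<Sum>i. (\<beta> powr - s) ^ length (W i)) < \<epsilon>"
proof -
  note gap = hole_length_pos[OF assms(1)]
  define K where "K = (\<beta> / hole_length) powr s"
  have K: "0 < K" using gap basic_ineqs(1) by (simp add: K_def)
  obtain C where C: "A \<subseteq> (\<Union>i. C i)" "\<And>i. bounded (C i)" "\<And>i. diameter (C i) \<le> hole_length / 2"
    and w: "(\<Sum>i. hausdorff_weight s (C i)) < ennreal (\<epsilon> / (2 * K))"
    using hausdorff_null_cover[OF assms(3), of "hole_length / 2" "\<epsilon> / (2 * K)"] gap assms(4) K by auto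
  define d where "d i = diameter (C i)" for i
  have d: "0 \<le> d i" "d i < hole_length" for i
    using C(2)[of i] C(3)[of i] gap diameter_ge_0 by (auto simp: d_def)
  have w': "(\<Sum>i. ennreal (d i powr s)) < ennreal (\<epsilon> / (2 * K))"
    using w assms(2) by (simp add: hausdorff_weight_pos d_def)
  have sd: "summable (\<lambda>i. d i powr s)"
    using w' by (intro summable_suminf_not_top) auto
  have "ennreal (\<Sum>i. d i powr s) = (\<Sum>i. ennreal (d i powr s))"
    by (rule suminf_ennreal2[symmetric]) (use sd in auto)
  hence "ennreal (\<Sum>i. d i powr s) < ennreal (\<epsilon> / (2 * K))" using w' by simp
  hence sumd: "(\<Sum>i. d i powr s) < \<epsilon> / (2 * K)"
    by (subst (asm) ennreal_less_iff) (auto intro!: suminf_nonneg sd)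
  define \<eta> where "\<eta> i = \<epsilon> / 2 * (1 / 2) ^ Suc i" for i :: nat
  have "\<exists>m. d i < hole_length / \<beta> ^ m \<and> (\<beta> powr - s) ^ m \<le> K * d i powr s + \<eta> i" for i
    unfolding K_def using assms(1,2,4) d by (intro scale_choice) (auto simp: \<eta>_def)
  then obtain m where m: "\<And>i. d i < hole_length / \<beta> ^ m i"
    "\<And>i. (\<beta> powr - s) ^ m i \<le> K * d i powr s + \<eta> i" by metis
  \<comment> \<open>If no cylinder of length \<open>m i\<close> meets \<open>C i\<close>, any word of that length will do.\<close>
  have "\<exists>w. length w = m i \<and> (\<forall>x\<in>C i. \<forall>u. length u = m i \<and> x \<in> cyl u \<longrightarrow> u = w)" for i
  proof (cases "\<exists>u. length u = m i \<and> C i \<inter> cyl u \<noteq> {}")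
    case True
    then obtain w y where w: "length w = m i" "y \<in> C i" "y \<in> cyl w" by blast
    have "u = w" if "x \<in> C i" "length u = m i" "x \<in> cyl u" for x u
    proof (rule ccontr)
      assume "u \<noteq> w"
      hence "hole_length \<le> \<beta> ^ m i * \<bar>x - y\<bar>" using cyl_separated[of u w x y] that w by simp
      moreover have "\<bar>x - y\<bar> \<le> d i"
        using diameter_bounded_bound[OF C(2) that(1) w(2)] by (simp add: d_def dist_real_def)
      hence "\<bar>x - y\<bar> < hole_length / \<beta> ^ m i" using m(1)[of i] by simp
      moreover have "0 < \<beta> ^ m i" using basic_ineqs(1) by simp
      ultimately show False by (simp add: pos_less_divide_eq mult.commute)
    qed
    thus ?thesis using w by blast
  next
    case False
    thus ?thesis by (intro exI[of _ "replicate (m i) False"]) auto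
  qed
  then obtain W where W: "\<And>i. length (W i) = m i"
    "\<And>i x u. x \<in> C i \<Longrightarrow> length u = m i \<Longrightarrow> x \<in> cyl u \<Longrightarrow> u = W i" by metis
  have "\<exists>i n. W i = map e [0..<n]" if "x \<in> A" "itinerary e x" for x e
  proof -
    obtain i where "x \<in> C i" using C(1) \<open>x \<in> A\<close> by blast
    hence "map e [0..<m i] = W i" using W(2)[of x i "map e [0..<m i]"] that(2) by (simp add: itinerary_def)
    thus ?thesis by metis
  qed
  moreover have s\<eta>: "\<eta> sums (\<epsilon> / 2)"
  proof -
    have "(\<lambda>i. \<epsilon> / 2 * (1 / 2) ^ Suc i) sums (\<epsilon> / 2 * 1)"
      by (intro sums_mult power_half_series)
    thus ?thesis by (simp add: \<eta>_def[abs_def])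
  qed
  have sb: "summable (\<lambda>i. K * d i powr s + \<eta> i)"
    using sd s\<eta> by (intro summable_add summable_mult) (auto simp: sums_iff)
  have sW: "summable (\<lambda>i. (\<beta> powr - s) ^ length (W i))"
    using m(2) by (intro summable_comparison_test'[OF sb, of 0]) (auto simp: W)
  moreover have "(\<Sum>i. (\<beta> powr - s) ^ length (W i)) < \<epsilon>"
  proof -
    have "(\<Sum>i. (\<beta> powr - s) ^ length (W i)) \<le> (\<Sum>i. K * d i powr s + \<eta> i)"
      using m(2) by (intro suminf_le sW sb) (auto simp: W)
    also have "\<dots> = (\<Sum>i. K * d i powr s) + (\<Sum>i. \<eta> i)"
      using sd s\<eta> by (intro suminf_add[symmetric] summable_mult) (auto simp: sums_iff)
    also have "\<dots> = K * (\<Sum>i. d i powr s) + \<epsilon> / 2"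
      using sd s\<eta> by (simp add: suminf_mult sums_iff)
    also have "\<dots> < K * (\<epsilon> / (2 * K)) + \<epsilon> / 2"
      using mult_strict_left_mono[OF sumd K] by (rule add_strict_right_mono)
    also have "\<dots> = \<epsilon>" using K by simp
    finally show ?thesis .
  qed
  ultimately show ?thesis by blast
qed

text \<open>
  Furstenberg's argument. A finite family \<open>F\<close> of words with \<open>\<Sum>w\<in>F. \<beta> powr (- s * |w|) < 1\<close>, one of
  which is a prefix of every long word, bounds the number of words of length \<open>n\<close> by the sum over
  \<open>F\<close> of the numbers of words of length \<open>n - |w|\<close>; the bound follows by induction.
\<close>
lemma words_growth_of_null:
  assumes "\<beta> < 2" "0 < s" "hausdorff_measure s (univoque_set \<beta>) = 0"
  shows "\<exists>C. \<forall>n. real (card (words n)) \<le> C * (\<beta> powr s) ^ n"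
proof -
  define \<rho> where "\<rho> = \<beta> powr - s"
  obtain W1 where W1: "\<And>x e. x \<in> univoque_set \<beta> \<Longrightarrow> itinerary e x \<Longrightarrow> \<exists>i n. W1 i = map e [0..<n]"
      "summable (\<lambda>i. \<rho> ^ length (W1 i))" "(\<Sum>i. \<rho> ^ length (W1 i)) < 1 / 2"
    using covering_words[OF assms, of "1 / 2"] unfolding \<rho>_def by (metis half_gt_zero zero_less_one)
  obtain W2 where W2: "\<And>x e. x \<in> boundary_hitting \<Longrightarrow> itinerary e x \<Longrightarrow> \<exists>i n. W2 i = map e [0..<n]"
      "summable (\<lambda>i. \<rho> ^ length (W2 i))" "(\<Sum>i. \<rho> ^ length (W2 i)) < 1 / 2"
    using covering_words[OF assms(1,2) hausdorff_null_countable[OF countable_boundary_hitting assms(2)], of "1 / 2"]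
    unfolding \<rho>_def by (metis half_gt_zero zero_less_one)
  define R where "R = range W1 \<union> range W2"
  \<comment> \<open>If \<open>B\<close> were infinite, it would contain all prefixes of some itinerary, but one of them is in \<open>R\<close>.\<close>
  define B where "B = {u. u \<in> words (length u) \<and> (\<forall>w\<in>R. \<forall>v. u \<noteq> w @ v)}"
  have "finite B"
  proof (rule ccontr)
    assume "infinite B"
    moreover have "u \<in> B" if "u @ v \<in> B" for u v
      using that words_append[of u v "length v"] unfolding B_def by auto
    ultimately obtain e where e: "\<And>n. map e [0..<n] \<in> B" using koenig_binary by blast
    hence "map e [0..<n] \<in> words n" for n unfolding B_def by fastforce
    then obtain x where "itinerary e x" using words_itinerary by blast
    hence "(\<exists>i n. W1 i = map e [0..<n]) \<or> (\<exists>i n. W2 i = map e [0..<n])"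
      using W1(1) W2(1) itinerary_univoque by blast
    then obtain n where "map e [0..<n] \<in> R" unfolding R_def by (metis UnCI rangeI)
    thus False using e[of n] unfolding B_def by (metis (mono_tags, lifting) append_Nil2 mem_Collect_eq)
  qed
  then obtain N where N: "\<And>u. u \<in> B \<Longrightarrow> length u < N"
    using finite_nat_set_iff_bounded[of "length ` B"] by auto
  define F where "F = {w \<in> R. length w \<le> N}"
  have "finite F"
    by (rule finite_subset[OF _ finite_lists_length_le[of UNIV N]]) (auto simp: F_def)
  have \<rho>: "0 < \<rho>" using basic_ineqs(1) by (simp add: \<rho>_def)
  have "(\<Sum>w\<in>F. \<rho> ^ length w) \<le> (\<Sum>w\<in>(F \<inter> range W1) \<union> (F \<inter> range W2). \<rho> ^ length w)"
    using \<open>finite F\<close> \<rho> by (intro sum_mono2) (auto simp: F_def R_def)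
  also have "\<dots> \<le> (\<Sum>w\<in>F \<inter> range W1. \<rho> ^ length w) + (\<Sum>w\<in>F \<inter> range W2. \<rho> ^ length w)"
    using \<open>finite F\<close> \<rho> by (subst sum_Un) (auto intro!: sum_nonneg)
  also have "\<dots> \<le> (\<Sum>i. \<rho> ^ length (W1 i)) + (\<Sum>i. \<rho> ^ length (W2 i))"
    using \<open>finite F\<close> \<rho> W1(2) W2(2)
    by (intro add_mono sum_le_suminf_of_range) auto
  finally have F: "(\<Sum>w\<in>F. \<rho> ^ length w) < 1" using W1(3) W2(3) by linarith
  \<comment> \<open>The empty word alone has weight 1. Its absence makes the induction on the length well-founded.\<close>
  have nonempty: "w \<noteq> []" if "w \<in> F" for w
  proof
    assume "w = []"
    hence "(\<Sum>w\<in>{[] :: bool list}. \<rho> ^ length w) \<le> (\<Sum>w\<in>F. \<rho> ^ length w)"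
      using \<open>finite F\<close> \<rho> that by (intro sum_mono2) auto
    thus False using F by simp
  qed
  define \<sigma> where "\<sigma> = \<beta> powr s"
  have \<sigma>: "1 \<le> \<sigma>" "\<sigma> * \<rho> = 1"
    using base_gt_1 assms(2) by (auto simp: \<sigma>_def \<rho>_def ge_one_powr_ge_zero simp flip: powr_add)
  have "real (card (words n)) \<le> 2 ^ N * \<sigma> ^ n" for n
  proof (induction n rule: less_induct)
    case (less n)
    show ?case
    proof (cases "n < N")
      case True
      have "real (card (words n)) \<le> 2 ^ n"
        using card_words_le[of n] by (metis of_nat_le_iff of_nat_numeral of_nat_power)
      also have "\<dots> \<le> 2 ^ N * 1" using True by simp
      also have "\<dots> \<le> 2 ^ N * \<sigma> ^ n" using \<sigma> by (intro mult_left_mono one_le_power) auto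
      finally show ?thesis .
    next
      case False
      have "words n \<subseteq> (\<Union>w\<in>F. (@) w ` words (n - length w))"
      proof
        fix u assume u: "u \<in> words n"
        hence len: "length u = n" by (simp add: words_def)
        hence u': "take N u @ drop N u \<in> words (length (take N u) + (n - N))"
          using u False by simp
        have "take N u \<in> words (length (take N u))" using words_append[OF u'] by blast
        moreover have "take N u \<notin> B" using N[of "take N u"] len False by auto
        ultimately obtain w v where wv: "w \<in> R" "take N u = w @ v" unfolding B_def by blast
        have "length w + length v = N" using arg_cong[OF wv(2), of length] len False by simp
        hence "w \<in> F" using wv(1) by (simp add: F_def)
        have split: "u = w @ (v @ drop N u)" using wv(2) by (metis append.assoc append_take_drop_id)
        hence "length w \<le> n" using len by (metis le_add1 length_append)
        hence "w @ (v @ drop N u) \<in> words (length w + (n - length w))" using u split by simp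
        hence "v @ drop N u \<in> words (n - length w)" using words_append by blast
        thus "u \<in> (\<Union>w\<in>F. (@) w ` words (n - length w))" using split \<open>w \<in> F\<close> by blast
      qed
      hence "card (words n) \<le> card (\<Union>w\<in>F. (@) w ` words (n - length w))"
        using \<open>finite F\<close> finite_words by (intro card_mono) auto
      also have "\<dots> \<le> (\<Sum>w\<in>F. card ((@) w ` words (n - length w)))"
        by (rule card_UN_le[OF \<open>finite F\<close>])
      also have "\<dots> \<le> (\<Sum>w\<in>F. card (words (n - length w)))"
        by (intro sum_mono card_image_le finite_words)
      finally have "real (card (words n)) \<le> real (\<Sum>w\<in>F. card (words (n - length w)))"
        by (rule of_nat_mono)
      also have "\<dots> = (\<Sum>w\<in>F. real (card (words (n - length w))))"
        by (rule of_nat_sum)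
      also have "\<dots> \<le> (\<Sum>w\<in>F. 2 ^ N * \<sigma> ^ n * \<rho> ^ length w)"
      proof (rule sum_mono)
        fix w assume w: "w \<in> F"
        have l: "length w \<le> n" using w False by (simp add: F_def)
        have "real (card (words (n - length w))) \<le> 2 ^ N * \<sigma> ^ (n - length w)"
          using less.IH[of "n - length w"] nonempty[OF w] l by (cases "w") auto
        also have "\<sigma> ^ (n - length w) = \<sigma> ^ n * \<rho> ^ length w"
        proof -
          have "\<sigma> ^ n = \<sigma> ^ (n - length w) * \<sigma> ^ length w" using l by (simp flip: power_add)
          moreover have "\<sigma> ^ length w * \<rho> ^ length w = 1" using \<sigma>(2) by (simp flip: power_mult_distrib)
          ultimately show ?thesis by (simp add: mult.assoc)
        qed
        finally show "real (card (words (n - length w))) \<le> 2 ^ N * \<sigma> ^ n * \<rho> ^ length w" by simp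
      qed
      also have "\<dots> = 2 ^ N * \<sigma> ^ n * (\<Sum>w\<in>F. \<rho> ^ length w)" by (simp add: sum_distrib_left)
      also have "\<dots> \<le> 2 ^ N * \<sigma> ^ n * 1" using F \<sigma> by (intro mult_left_mono) auto
      finally show ?thesis by simp
    qed
  qed
  thus ?thesis unfolding \<sigma>_def by blast
qed

section \<open>The growth exponent and the dimension\<close>

definition growth_bound :: "real \<Rightarrow> bool" where
  "growth_bound s \<longleftrightarrow> (\<exists>C. \<forall>n. real (card (words n)) \<le> C * (\<beta> powr s) ^ n)"

text \<open>The topological entropy of the language, divided by \<open>ln \<beta>\<close>.\<close>
definition growth_exponent :: real where
  "growth_exponent = Inf {s. growth_bound s}"

lemma growth_bound_nonneg:
  assumes "growth_bound s"
  shows "0 \<le> s"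
proof (rule ccontr)
  assume "\<not> 0 \<le> s"
  hence "\<beta> powr s < 1" using base_gt_1 by (simp add: powr_less_one)
  obtain C where C: "\<And>n. real (card (words n)) \<le> C * (\<beta> powr s) ^ n"
    using assms unfolding growth_bound_def by blast
  have "(\<lambda>n. C * (\<beta> powr s) ^ n) \<longlonglongrightarrow> C * 0"
    using \<open>\<beta> powr s < 1\<close> by (intro tendsto_mult tendsto_const LIMSEQ_realpow_zero) auto
  moreover have "1 \<le> C * (\<beta> powr s) ^ n" for n
    using C[of n] card_words_pos[of n] by linarith
  ultimately have "1 \<le> C * 0" by (intro LIMSEQ_le_const) auto
  thus False by simp
qed

lemma growth_bound_mono:
  assumes "growth_bound s" "s \<le> t"
  shows "growth_bound t"
proof -
  obtain C where C: "\<And>n. real (card (words n)) \<le> C * (\<beta> powr s) ^ n"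
    using assms unfolding growth_bound_def by blast
  have "0 \<le> C" using C[of 0] by simp
  hence "C * (\<beta> powr s) ^ n \<le> C * (\<beta> powr t) ^ n" for n
    using assms(2) base_gt_1 by (intro mult_left_mono power_mono powr_mono) auto
  thus ?thesis unfolding growth_bound_def using C order_trans by meson
qed

lemma growth_bound_trivial: "growth_bound (log \<beta> 2)"
proof -
  have "real (card (words n)) \<le> 1 * (\<beta> powr log \<beta> 2) ^ n" for n
    using card_words_le[of n] base_gt_1
    by (simp add: powr_log_cancel)
  thus ?thesis unfolding growth_bound_def by blast
qed

lemma growth_exponent_le: "growth_bound s \<Longrightarrow> growth_exponent \<le> s"
  unfolding growth_exponent_def
  by (intro cInf_lower bdd_belowI[of _ 0]) (auto simp: growth_bound_nonneg)

lemma growth_exponent_nonneg: "0 \<le> growth_exponent"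
  unfolding growth_exponent_def
  by (intro cInf_greatest) (use growth_bound_trivial growth_bound_nonneg in auto)

lemma growth_bound_above: "growth_exponent < s \<Longrightarrow> growth_bound s"
proof -
  assume "growth_exponent < s"
  then obtain t where "growth_bound t" "t < s"
    unfolding growth_exponent_def using growth_bound_trivial
    by (metis (mono_tags, lifting) cInf_lessD empty_iff mem_Collect_eq)
  thus ?thesis using growth_bound_mono by simp
qed

lemma card_words_mult: "card (words (k * n)) \<le> card (words n) ^ k"
proof (induction k)
  case 0
  show ?case using card_words_le[of 0] by simp
next
  case (Suc k)
  have "card (words (Suc k * n)) \<le> card (words n) * card (words (k * n))"
    using card_words_add[of n "k * n"] by simp
  also have "\<dots> \<le> card (words n) * card (words n) ^ k" using Suc by simp
  finally show ?case by simp
qed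

text \<open>
  By submultiplicativity a single \<open>n\<close> with fewer words would force a smaller growth rate: cut words
  into blocks of length \<open>n\<close>.
\<close>
lemma card_words_ge_growth: "(\<beta> powr growth_exponent) ^ n \<le> card (words n)"
proof (rule ccontr)
  assume less: "\<not> (\<beta> powr growth_exponent) ^ n \<le> card (words n)"
  have n: "0 < n" using less card_words_pos[of 0] by (cases n) auto
  define a where "a = real (card (words n))"
  have a: "1 \<le> a" using card_words_pos[of n] by (simp add: a_def)
  \<comment> \<open>The exponent for which the number of words of length \<open>n\<close> is exactly \<open>\<beta> powr (s * n)\<close>.\<close>
  define s where "s = log \<beta> a / n"
  have \<beta>s: "(\<beta> powr s) ^ n = a"
    using a n base_gt_1 by (simp add: s_def powr_powr powr_log_cancel flip: powr_realpow)
  have "(\<beta> powr s) ^ n < (\<beta> powr growth_exponent) ^ n" using less \<beta>s by (simp add: a_def)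
  hence "\<beta> powr s < \<beta> powr growth_exponent" by (rule power_less_imp_less_base) simp
  hence "s < growth_exponent" using base_gt_1 by simp
  moreover have "growth_bound s"
  proof -
    have "0 \<le> s" using a base_gt_1 by (simp add: s_def)
    hence s1: "1 \<le> \<beta> powr s" using base_gt_1 by (simp add: ge_one_powr_ge_zero)
    have "real (card (words m)) \<le> 2 ^ n * (\<beta> powr s) ^ m" for m
    proof -
      define k r where "k = m div n" and "r = m mod n"
      have m: "m = k * n + r" and r: "r < n" using n by (simp_all add: k_def r_def)
      have "card (words m) \<le> card (words (k * n)) * card (words r)"
        unfolding m by (rule card_words_add)
      also have "\<dots> \<le> card (words n) ^ k * 2 ^ r"
        using card_words_mult card_words_le by (intro mult_mono) auto
      finally have "real (card (words m)) \<le> real (card (words n) ^ k * 2 ^ r)"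
        by (rule of_nat_mono)
      also have "\<dots> = a ^ k * 2 ^ r" by (simp add: a_def)
      also have "a ^ k = (\<beta> powr s) ^ (k * n)" 
        unfolding \<beta>s[symmetric] by (simp add: mult.commute flip: power_mult)
      also have "(\<beta> powr s) ^ (k * n) * 2 ^ r \<le> (\<beta> powr s) ^ m * 2 ^ n"
        using s1 r m by (intro mult_mono power_increasing) auto
      finally show ?thesis by (simp add: mult.commute)
    qed
    thus ?thesis unfolding growth_bound_def by blast
  qed
  ultimately show False using growth_exponent_le by force
qed

text \<open>
  The cover by all cylinders of length \<open>n\<close> has weight of order \<open>\<beta> powr ((t - s) * n)\<close> for any \<open>t\<close>
  strictly between the growth exponent and \<open>s\<close>.
\<close>
lemma hausdorff_null_above_growth:
  assumes "growth_exponent < s"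
  shows "hausdorff_measure s (univoque_set \<beta>) = 0"
proof (rule hausdorff_nullI)
  fix \<delta> e :: real assume \<delta>: "0 < \<delta>" and e: "0 < e"
  obtain t where t: "growth_exponent < t" "t < s" using dense[OF assms] by blast
  have s: "0 < s" using t growth_exponent_nonneg by linarith
  obtain C where C: "\<And>n. real (card (words n)) \<le> C * (\<beta> powr t) ^ n"
    using growth_bound_above[OF t(1)] unfolding growth_bound_def by blast
  define L where "L = 1 / (\<beta> - 1)"
  have L: "0 < L" using basic_ineqs(2) by (simp add: L_def)
  have diam: "diameter (cyl w) \<le> L / \<beta> ^ length w" for w
    using cyl_dist[of _ w] L basic_ineqs(1)
    by (intro diameter_le) (auto simp: L_def)
  have "(\<lambda>n. L * (1 / \<beta>) ^ n) \<longlonglongrightarrow> L * 0"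
    using basic_ineqs by (intro tendsto_mult tendsto_const LIMSEQ_realpow_zero) auto
  hence "\<forall>\<^sub>F n in sequentially. L * (1 / \<beta>) ^ n < \<delta>"
    using \<delta> order_tendstoD(2) by fastforce
  moreover have "(\<lambda>n. C * L powr s * (\<beta> powr (t - s)) ^ n) \<longlonglongrightarrow> C * L powr s * 0"
    using t base_gt_1
    by (intro tendsto_mult tendsto_const LIMSEQ_realpow_zero) (auto simp: powr_less_one)
  hence "\<forall>\<^sub>F n in sequentially. C * L powr s * (\<beta> powr (t - s)) ^ n < e"
    using e order_tendstoD(2) by fastforce
  ultimately have "\<forall>\<^sub>F n in sequentially. L * (1 / \<beta>) ^ n < \<delta> \<and> C * L powr s * (\<beta> powr (t - s)) ^ n < e"
    by (rule eventually_conj)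
  then obtain n where n: "L / \<beta> ^ n < \<delta>" "C * L powr s * (\<beta> powr (t - s)) ^ n < e"
    unfolding eventually_sequentially by (auto simp: power_one_over)
  obtain h where h: "bij_betw h {..<card (words n)} (words n)"
    using ex_bij_betw_nat_finite[OF finite_words] by (metis atLeast0LessThan)
  define D where "D i = (if i < card (words n) then cyl (h i) else {})" for i
  have len: "length (h i) = n" if "i < card (words n)" for i
    using h that unfolding bij_betw_def words_def by blast
  have "univoque_set \<beta> \<subseteq> (\<Union>i. D i)"
  proof
    fix x assume "x \<in> univoque_set \<beta>"
    then obtain w where w: "w \<in> words n" "x \<in> cyl w" using univoque_in_cyl by blast
    then obtain i where "i < card (words n)" "w = h i" using h unfolding bij_betw_def by blast
    thus "x \<in> (\<Union>i. D i)" using w(2) by (auto simp: D_def)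
  qed
  moreover have "bounded (D i) \<and> diameter (D i) \<le> \<delta>" for i
    using diam[of "h i"] len[of i] n(1) \<delta> compact_imp_bounded[OF cyl_compact] by (auto simp: D_def)
  moreover have "(\<Sum>i. hausdorff_weight s (D i)) \<le> ennreal e"
  proof -
    have "(\<Sum>i. hausdorff_weight s (D i)) = (\<Sum>i<card (words n). hausdorff_weight s (D i))"
      using s by (intro suminf_finite) (auto simp: D_def hausdorff_weight_pos)
    also have "\<dots> \<le> (\<Sum>i<card (words n). ennreal ((L / \<beta> ^ n) powr s))"
    proof (rule sum_mono)
      fix i assume "i \<in> {..<card (words n)}"
      hence "diameter (D i) \<le> L / \<beta> ^ n" using diam[of "h i"] len[of i] by (simp add: D_def)
      moreover have "0 \<le> diameter (D i)"
        using compact_imp_bounded[OF cyl_compact] by (auto simp: D_def intro!: diameter_ge_0)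
      ultimately show "hausdorff_weight s (D i) \<le> ennreal ((L / \<beta> ^ n) powr s)"
        unfolding hausdorff_weight_pos[OF s] using s by (intro ennreal_leI powr_mono2) auto
    qed
    also have "\<dots> = ennreal (card (words n) * (L / \<beta> ^ n) powr s)"
      by (simp add: ennreal_mult ennreal_of_nat_eq_real_of_nat)
    also have "\<dots> \<le> ennreal e"
    proof (rule ennreal_leI)
      have \<beta>: "0 < \<beta>" by (rule basic_ineqs(1))
      have "(L / \<beta> ^ n) powr s = L powr s * (\<beta> powr - s) ^ n"
        unfolding divide_inverse inverse_power_powr[symmetric] using L \<beta> by (intro powr_mult)
      hence "real (card (words n)) * (L / \<beta> ^ n) powr s
          \<le> C * (\<beta> powr t) ^ n * (L powr s * (\<beta> powr - s) ^ n)"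
        using C[of n] by (simp add: mult_right_mono)
      also have "\<dots> = C * L powr s * (\<beta> powr t * \<beta> powr - s) ^ n" by (simp add: power_mult_distrib)
      also have "\<beta> powr t * \<beta> powr - s = \<beta> powr (t - s)" by (simp flip: powr_add)
      finally show "real (card (words n)) * (L / \<beta> ^ n) powr s \<le> e" using n(2) by simp
    qed
    finally show ?thesis .
  qed
  ultimately show "\<exists>C. univoque_set \<beta> \<subseteq> (\<Union>i. C i) \<and> (\<forall>i. bounded (C i) \<and> diameter (C i) \<le> \<delta>) \<and>
      (\<Sum>i. hausdorff_weight s (C i)) \<le> ennreal e"
    by blast
qed

lemma zero_univoque: "0 \<in> univoque_set \<beta>"
proof (rule itinerary_univoque)
  have 0: "walk w 0 \<le> 0" for w
  proof -
    have "walk w x \<le> 0" if "x \<le> 0" for x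
      using that
    proof (induction w arbitrary: x)
      case (Cons d w)
      have "\<beta> * x \<le> 0" using Cons.prems basic_ineqs(1) by (simp add: mult_le_0_iff)
      thus ?case using Cons.IH[of "\<beta> * x - of_bool d"] by simp
    qed simp
    thus ?thesis by simp
  qed
  show "0 \<notin> boundary_hitting"
  proof -
    have "walk w 0 \<noteq> 1 / \<beta> \<and> walk w 0 \<noteq> 1 / (\<beta> * (\<beta> - 1))" for w
      using 0[of w] basic_ineqs(3,5) by linarith
    thus ?thesis unfolding boundary_hitting_def by blast
  qed
  show "itinerary (\<lambda>_. False) 0"
    using zero_in_cyl unfolding itinerary_def by (simp add: map_replicate_const)
qed

lemma hausdorff_dim_univoque:
  assumes "\<beta> < 2"
  shows "hausdorff_dim (univoque_set \<beta>) = ereal growth_exponent"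
proof (rule hausdorff_dim_eqI)
  fix s :: real assume s: "0 \<le> s" "hausdorff_measure s (univoque_set \<beta>) = 0"
  hence "0 < s" using hausdorff_nonnull_0[of "univoque_set \<beta>"] zero_univoque by (cases "s = 0") auto
  thus "growth_exponent \<le> s"
    using words_growth_of_null[OF assms _ s(2)] growth_exponent_le unfolding growth_bound_def by blast
qed (use growth_exponent_nonneg hausdorff_null_above_growth in auto)

section \<open>The measure of first-entry sets\<close>

lemma greedy_map_unit: "x \<in> {0..<1} \<Longrightarrow> greedy_map \<beta> x \<in> {0..<1}"
proof -
  assume x: "x \<in> {0..<1}"
  have "x < 1 / \<beta> \<longleftrightarrow> \<beta> * x < 1" using basic_ineqs(1) by (simp add: field_simps)
  moreover have "\<beta> * x < \<beta> * 1" using x basic_ineqs(1) by (intro mult_strict_left_mono) auto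
  hence "\<beta> * x < 2" using base_le_2 by simp
  ultimately show ?thesis using x basic_ineqs(1) by (auto simp: greedy_map_def)
qed

lemma greedy_survivor_in_cyl:
  assumes "x \<in> {0..<1}" "\<forall>k<n. (greedy_map \<beta> ^^ k) x \<notin> hole \<beta> \<inter> {0..<1}"
  shows "\<exists>w\<in>words n. x \<in> cyl w \<and> walk w x = (greedy_map \<beta> ^^ n) x"
  using assms
proof (induction n arbitrary: x)
  case 0
  have "x \<in> cyl []" using 0(1) basic_ineqs(7) by auto
  moreover from this have "[] \<in> words 0" unfolding words_def by blast
  ultimately show ?case by (intro bexI[of _ "[]"]) auto
next
  case (Suc n)
  define d where "d = (\<not> x < 1 / \<beta>)"
  have g: "greedy_map \<beta> x = \<beta> * x - of_bool d" by (simp add: greedy_map_def d_def)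
  have "x \<notin> hole \<beta>" using Suc.prems by force
  hence x: "x \<in> branch d"
    using Suc.prems(1) basic_ineqs(7) by (cases d) (auto simp: d_def hole_def)
  have "\<forall>k<n. (greedy_map \<beta> ^^ k) (greedy_map \<beta> x) \<notin> hole \<beta> \<inter> {0..<1}"
    using Suc.prems(2) unfolding All_less_Suc2 by (simp add: funpow_swap1)
  then obtain w where "w \<in> words n" "greedy_map \<beta> x \<in> cyl w"
      "walk w (greedy_map \<beta> x) = (greedy_map \<beta> ^^ n) (greedy_map \<beta> x)"
    using Suc.IH[OF greedy_map_unit[OF Suc.prems(1)]] by blast
  thus ?case using x unfolding g
    by (intro bexI[of _ "d # w"]) (auto simp: words_def funpow_swap1 g)
qed

lemma first_entry_set_Suc:
  assumes "x \<in> {0..<1}" "x \<notin> hole \<beta>" "greedy_map \<beta> x \<in> first_entry_set \<beta> n"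
  shows "x \<in> first_entry_set \<beta> (Suc n)"
  using assms unfolding first_entry_set_def
  by (auto simp: funpow_swap1 All_less_Suc2)

text \<open>
  Off \<open>boundary_hitting\<close> an orbit in the closed branches avoids the hole, and the greedy map then
  chooses the digit of the branch.
\<close>
lemma cyl_in_first_entry_set:
  assumes "x \<in> cyl w" "x \<in> {0..<1}" "x \<notin> boundary_hitting" "walk w x \<in> hole \<beta>"
  shows "x \<in> first_entry_set \<beta> (length w)"
  using assms
proof (induction w arbitrary: x)
  case Nil
  thus ?case by (auto simp: first_entry_set_def)
next
  case (Cons d w)
  have "walk [] x \<notin> {1 / \<beta>, 1 / (\<beta> * (\<beta> - 1))}"
    using Cons.prems(3) unfolding boundary_hitting_def by blast
  hence "x \<notin> hole \<beta>" and g: "greedy_map \<beta> x = \<beta> * x - of_bool d"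
    using Cons.prems(1) basic_ineqs(5) by (cases d; force simp: hole_def greedy_map_def)+
  moreover have "\<beta> * x - of_bool d \<notin> boundary_hitting"
    using boundary_hitting_step[OF Cons.prems(3), of "[d]"] by simp
  moreover have "\<beta> * x - of_bool d \<in> {0..<1}"
    using greedy_map_unit[OF Cons.prems(2)] unfolding g .
  ultimately have "greedy_map \<beta> x \<in> first_entry_set \<beta> (length w)"
    unfolding g using Cons.prems by (intro Cons.IH) auto
  thus ?case using first_entry_set_Suc[OF Cons.prems(2) \<open>x \<notin> hole \<beta>\<close>] by simp
qed

lemma first_entry_set_fmeasurable: "first_entry_set \<beta> n \<in> fmeasurable lborel"
proof -
  have [measurable]: "greedy_map \<beta> \<in> borel_measurable borel"
    unfolding greedy_map_def[abs_def] by measurable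
  have [measurable]: "(greedy_map \<beta> ^^ k) \<in> borel_measurable borel" for k
  proof (induction k)
    case (Suc k)
    thus ?case by (simp add: measurable_comp[OF Suc])
  qed (simp add: id_def)
  have [measurable]: "hole \<beta> \<in> sets borel" by (simp add: hole_def)
  have "first_entry_set \<beta> n \<in> sets lborel" unfolding first_entry_set_def by measurable
  moreover have "first_entry_set \<beta> n \<subseteq> {0..1}" by (auto simp: first_entry_set_def)
  moreover have "{0..1::real} \<in> fmeasurable lborel" by (intro fmeasurable_compact) auto
  ultimately show ?thesis by (metis fmeasurableI2)
qed

lemma measure_first_entry_set_le:
  "measure lborel (first_entry_set \<beta> n) \<le> card (words n) * (2 / (\<beta> - 1) / \<beta> ^ n)"
proof -
  have "measure lborel (first_entry_set \<beta> n) \<le> measure lborel (\<Union>w\<in>words n. cyl w)"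
  proof (rule measure_mono_fmeasurable)
    show "first_entry_set \<beta> n \<subseteq> (\<Union>w\<in>words n. cyl w)"
      using greedy_survivor_in_cyl unfolding first_entry_set_def by blast
    show "(\<Union>w\<in>words n. cyl w) \<in> fmeasurable lborel"
      using finite_words cyl_compact by (intro fmeasurable_compact compact_UN) auto
  qed (rule fmeasurableD[OF first_entry_set_fmeasurable])
  also have "\<dots> \<le> (\<Sum>w\<in>words n. measure lborel (cyl w))"
    using finite_words cyl_closed by (intro measure_UNION_le) auto
  also have "\<dots> \<le> (\<Sum>w\<in>words n. 2 / (\<beta> - 1) / \<beta> ^ n)"
  proof (rule sum_mono)
    fix w assume w: "w \<in> words n"
    then obtain x where x: "x \<in> cyl w" by (auto simp: words_def)
    define r where "r = 1 / (\<beta> - 1) / \<beta> ^ n"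
    have r: "0 \<le> r" using basic_ineqs by (simp add: r_def)
    have "cyl w \<subseteq> {x - r..x + r}"
      using cyl_dist[OF _ x] w by (force simp: r_def words_def abs_le_iff)
    hence "measure lborel (cyl w) \<le> measure lborel {x - r..x + r}"
      using cyl_closed by (intro measure_mono_fmeasurable fmeasurable_compact) auto
    also have "\<dots> = 2 * r" using r by simp
    finally show "measure lborel (cyl w) \<le> 2 / (\<beta> - 1) / \<beta> ^ n" by (simp add: r_def)
  qed
  finally show ?thesis by simp
qed

lemma measure_first_entry_set_ge:
  assumes "S \<in> sets lborel" "S - boundary_hitting \<subseteq> first_entry_set \<beta> n"
  shows "measure lborel S \<le> measure lborel (first_entry_set \<beta> n)"
proof -
  have null: "boundary_hitting \<in> null_sets lborel"
    by (rule countable_imp_null_set_lborel[OF countable_boundary_hitting])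
  have "measure lborel S = measure lborel (S - boundary_hitting)"
    using assms(1) null by (simp add: measure_Diff_null_set)
  also have "\<dots> \<le> measure lborel (first_entry_set \<beta> n)"
    using assms null first_entry_set_fmeasurable by (intro measure_mono_fmeasurable) auto
  finally show ?thesis .
qed

text \<open>
  For \<open>n > 0\<close> the points with \<open>\<beta> ^ n * x\<close> in the part of the hole below 1 reach the hole after \<open>n\<close>
  digits 0. This alone bounds the escape rate by 1 and settles the case of subexponential growth.
\<close>
lemma measure_first_entry_set_ge_power:
  "\<exists>c>0. \<forall>n>0. c / \<beta> ^ n \<le> measure lborel (first_entry_set \<beta> n)" if "\<beta> < 2"
proof -
  define r where "r = min 1 (1 / (\<beta> * (\<beta> - 1)))"
  have r: "1 / \<beta> < r" "r \<le> 1" "r \<le> 1 / (\<beta> * (\<beta> - 1))"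
    using hole_length_pos[OF that] basic_ineqs by (auto simp: r_def hole_length_def)
  have "(r - 1 / \<beta>) / \<beta> ^ n \<le> measure lborel (first_entry_set \<beta> n)" if n: "0 < n" for n
  proof -
    define S where "S = {(1 / \<beta>) / \<beta> ^ n .. r / \<beta> ^ n}"
    have walk: "walk (replicate k False) x = \<beta> ^ k * x" for k x
      by (induction k arbitrary: x) auto
    have cyl: "x \<in> cyl (replicate (Suc k) False)" if "0 \<le> x" "\<beta> ^ Suc k * x \<le> 1" for k x
      using that
    proof (induction k arbitrary: x)
      case 0
      hence "x \<le> 1 / \<beta>" using basic_ineqs(1) by (simp add: field_simps)
      thus ?case using 0 basic_ineqs(1,7) by simp
    next
      case (Suc k)
      have "\<beta> * x \<in> cyl (replicate (Suc k) False)"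
      proof (rule Suc.IH)
        show "0 \<le> \<beta> * x" using Suc.prems(1) basic_ineqs(1) by simp
        show "\<beta> ^ Suc k * (\<beta> * x) \<le> 1"
          using Suc.prems(2) by (metis power_Suc2 mult.assoc)
      qed
      moreover have "\<beta> * x \<le> \<beta> ^ Suc (Suc k) * x"
        using Suc.prems(1) base_gt_1 by (intro mult_right_mono self_le_power) auto
      hence "\<beta> * x \<le> 1" using Suc.prems(2) by (rule order_trans)
      hence "x \<le> 1 / \<beta>" using basic_ineqs(1) by (simp add: field_simps)
      ultimately show ?case using Suc.prems(1) by simp
    qed
    have "S - boundary_hitting \<subseteq> first_entry_set \<beta> n"
    proof
      fix x assume x: "x \<in> S - boundary_hitting"
      have p: "0 < \<beta> ^ n" using basic_ineqs(1) by simp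
      have "(1 / \<beta>) / \<beta> ^ n \<le> x" "x \<le> r / \<beta> ^ n" using x by (simp_all add: S_def)
      hence 1: "1 / \<beta> \<le> \<beta> ^ n * x" "\<beta> ^ n * x \<le> r"
        by (simp_all only: pos_divide_le_eq[OF p] pos_le_divide_eq[OF p] mult.commute)
      have "0 \<le> 1 / \<beta> / \<beta> ^ n" using basic_ineqs(1) by simp
      hence "0 \<le> x" using \<open>(1 / \<beta>) / \<beta> ^ n \<le> x\<close> by (rule order_trans)
      have "x \<in> cyl (replicate n False)"
        using cyl[of x "n - 1"] \<open>0 \<le> x\<close> 1 r n by simp
      moreover have "x \<in> {0..<1}"
      proof -
        have "x \<le> 1 / \<beta>" using calculation n by (cases n) auto
        thus ?thesis using \<open>0 \<le> x\<close> basic_ineqs(4) by auto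
      qed
      ultimately show "x \<in> first_entry_set \<beta> n"
        using cyl_in_first_entry_set[of x "replicate n False"] x 1 r by (simp add: walk hole_def)
    qed
    hence "measure lborel S \<le> measure lborel (first_entry_set \<beta> n)"
      by (intro measure_first_entry_set_ge) (auto simp: S_def)
    moreover have "(1 / \<beta>) / \<beta> ^ n \<le> r / \<beta> ^ n"
      using r basic_ineqs(1) by (intro divide_right_mono) auto
    hence "measure lborel S = (r - 1 / \<beta>) / \<beta> ^ n"
      unfolding S_def by (simp add: diff_divide_distrib)
    ultimately show ?thesis by simp
  qed
  thus ?thesis using r by (intro exI[of _ "r - 1 / \<beta>"]) auto
qed

definition branching :: "nat \<Rightarrow> bool list set" where
  "branching n = {w. w @ [False] \<in> words (Suc n) \<and> w @ [True] \<in> words (Suc n)}"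

lemma words_snoc: "w @ [d] \<in> words (Suc n) \<Longrightarrow> w \<in> words n"
  using words_append[of w "[d]" 1] by (auto simp: words_def)

lemma branching_subset: "branching n \<subseteq> words n"
  using words_snoc by (auto simp: branching_def)

lemma finite_branching: "finite (branching n)"
  using branching_subset finite_words finite_subset by blast

lemma card_words_Suc: "card (words (Suc n)) \<le> card (words n) + card (branching n)"
proof -
  define E where "E d = {w. w @ [d] \<in> words (Suc n)}" for d
  have E: "E d \<subseteq> words n" for d
    using words_snoc by (auto simp: E_def)
  hence fin: "finite (E d)" for d using finite_words finite_subset by blast
  have "words (Suc n) \<subseteq> (\<lambda>w. w @ [False]) ` E False \<union> (\<lambda>w. w @ [True]) ` E True"
  proof
    fix u assume u: "u \<in> words (Suc n)"
    hence "u \<noteq> []" by (auto simp: words_def)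
    then obtain w d where "u = w @ [d]" by (metis rev_exhaust)
    thus "u \<in> (\<lambda>w. w @ [False]) ` E False \<union> (\<lambda>w. w @ [True]) ` E True"
      using u by (cases d) (auto simp: E_def)
  qed
  hence "card (words (Suc n)) \<le> card ((\<lambda>w. w @ [False]) ` E False \<union> (\<lambda>w. w @ [True]) ` E True)"
    using fin by (intro card_mono) auto
  also have "\<dots> \<le> card (E False) + card (E True)"
    using card_Un_le card_image_le[OF fin] add_mono order_trans by meson
  also have "\<dots> = card (E False \<union> E True) + card (E False \<inter> E True)"
    using fin by (intro card_Un_Int)
  also have "\<dots> \<le> card (words n) + card (branching n)"
    using E finite_words finite_branching
    by (intro add_mono card_mono) (auto simp: E_def branching_def)
  finally show ?thesis .
qed

text \<open>
  If \<open>u @ v\<close> branches, both its continuations occur, hence so do their suffixes, which are the two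
  continuations of \<open>v\<close>.
\<close>
lemma card_branching_add: "card (branching (k + n)) \<le> 2 ^ k * card (branching n)"
proof -
  define U where "U = {u::bool list. set u \<subseteq> UNIV \<and> length u = k}"
  have U: "finite U" "card U = 2 ^ k"
    unfolding U_def by (rule finite_lists_length_eq[OF finite], subst card_lists_length_eq) auto
  have "branching (k + n) \<subseteq> (\<lambda>(u, v). u @ v) ` (U \<times> branching n)"
  proof
    fix w assume w: "w \<in> branching (k + n)"
    hence len: "length w = k + n" by (simp add: branching_def words_def)
    have "drop k w @ [d] \<in> words (Suc n)" for d
    proof -
      have "take k w @ (drop k w @ [d]) \<in> words (length (take k w) + Suc n)"
        using w len by (cases d) (auto simp: branching_def simp flip: append_assoc)
      thus ?thesis using words_append by blast
    qed
    thus "w \<in> (\<lambda>(u, v). u @ v) ` (U \<times> branching n)"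
      using len by (intro image_eqI[of _ _ "(take k w, drop k w)"]) (auto simp: branching_def U_def)
  qed
  hence "card (branching (k + n)) \<le> card ((\<lambda>(u, v). u @ v) ` (U \<times> branching n))"
    using U finite_branching by (intro card_mono) auto
  also have "\<dots> \<le> card (U \<times> branching n)"
    using U finite_branching by (intro card_image_le) auto
  finally show ?thesis using U by (simp add: card_cartesian_product)
qed

text \<open>
  New words arise only at branching ones, and by \<open>card_branching_add\<close> the branching words of all
  lengths from \<open>n\<close> to \<open>n + t - 1\<close> are controlled by those of length \<open>n\<close>. This is what bounds the
  number of branching words from below at every length.
\<close>
lemma card_words_add_branching:
  "card (words (n + t)) \<le> card (words n) + 2 ^ t * card (branching n)"
proof (induction t)
  case (Suc t)
  have "card (words (n + Suc t)) \<le> card (words (n + t)) + card (branching (t + n))"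
    using card_words_Suc[of "n + t"] by (simp add: add.commute)
  also have "\<dots> \<le> card (words n) + 2 ^ t * card (branching n) + 2 ^ t * card (branching n)"
    using Suc card_branching_add by (intro add_mono)
  finally show ?case by simp
qed simp

text \<open>The reflection \<open>x \<mapsto> 1/(\<beta>-1) - x\<close> exchanges the two branches and commutes with the map.\<close>
lemma cyl_reflect: "x \<in> cyl w \<Longrightarrow> 1 / (\<beta> - 1) - x \<in> cyl (map Not w)"
proof (induction w arbitrary: x)
  case (Cons d w)
  have b: "1 / (\<beta> - 1) - 1 / \<beta> = 1 / (\<beta> * (\<beta> - 1))" "\<beta> * (1 / (\<beta> - 1)) = 1 / (\<beta> - 1) + 1"
    using basic_ineqs(1,2) by (simp_all add: field_simps)
  have "1 / (\<beta> - 1) - x \<in> branch (\<not> d)"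
    using Cons.prems b(1) by (cases d) auto
  moreover have "\<beta> * (1 / (\<beta> - 1) - x) - of_bool (\<not> d) = 1 / (\<beta> - 1) - (\<beta> * x - of_bool d)"
    unfolding right_diff_distrib b(2) by simp
  moreover have "1 / (\<beta> - 1) - (\<beta> * x - of_bool d) \<in> cyl (map Not w)"
    using Cons by simp
  ultimately show ?case by (simp del: branch.simps)
qed auto

text \<open>
  Words that start with 0 have their cylinders in \<open>[0, 1)\<close>, where the escape is measured. By reflection
  they make up half of the branching words.
\<close>
lemma card_branching_le_half:
  "card (branching n) \<le> 2 * card {w \<in> branching n. \<not> hd w}" if "0 < n"
proof -
  have refl: "map Not w \<in> words k" if "w \<in> words k" for w k
    using that cyl_reflect by (fastforce simp: words_def)
  have "map Not w \<in> {w \<in> branching n. \<not> hd w}" if w: "w \<in> {w \<in> branching n. hd w}" for w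
  proof -
    have "w \<noteq> []" using w \<open>0 < n\<close> by (auto simp: branching_def words_def)
    thus ?thesis using w refl[of "w @ [True]" "Suc n"] refl[of "w @ [False]" "Suc n"]
      by (simp add: branching_def hd_map)
  qed
  hence "map Not ` {w \<in> branching n. hd w} \<subseteq> {w \<in> branching n. \<not> hd w}" by blast
  moreover have "inj_on (map Not) {w \<in> branching n. hd w}" by (auto simp: inj_on_def inj_map_eq_map inj_def)
  ultimately have "card {w \<in> branching n. hd w} \<le> card {w \<in> branching n. \<not> hd w}"
    using finite_branching by (intro card_inj_on_le) auto
  moreover have "card (branching n) \<le> card {w \<in> branching n. hd w} + card {w \<in> branching n. \<not> hd w}"
    by (rule order_trans[OF card_mono card_Un_le]) (use finite_branching in auto)
  ultimately show ?thesis by simp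
qed

text \<open>
  The cylinder contains points that are mapped to either side of the hole; by convexity it contains
  the whole preimage of the hole between them.
\<close>
lemma branching_interval:
  assumes "w \<in> branching n"
  shows "\<exists>z. {z..z + hole_length / \<beta> ^ n} \<subseteq> {x \<in> cyl w. walk w x \<in> hole \<beta>}"
proof -
  have len: "length w = n" using assms by (simp add: branching_def words_def)
  obtain a b where "a \<in> cyl (w @ [False])" "b \<in> cyl (w @ [True])"
    using assms unfolding branching_def words_def by blast
  hence ab: "a \<in> cyl w" "walk w a \<le> 1 / \<beta>" "b \<in> cyl w" "1 / (\<beta> * (\<beta> - 1)) \<le> walk w b"
    by (auto simp: cyl_append)
  have p: "0 < \<beta> ^ n" using basic_ineqs(1) by simp
  define z where "z = a + (1 / \<beta> - walk w a) / \<beta> ^ n"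
  have "{z..z + hole_length / \<beta> ^ n} \<subseteq> {x \<in> cyl w. walk w x \<in> hole \<beta>}"
  proof
    fix x assume x: "x \<in> {z..z + hole_length / \<beta> ^ n}"
    have wz: "walk w z = 1 / \<beta>"
      using walk_diff[of w z a] basic_ineqs(1) len by (simp add: z_def)
    have "0 \<le> walk w x - walk w z" "walk w x - walk w z \<le> hole_length"
    proof -
      show "0 \<le> walk w x - walk w z" using x p by (simp add: walk_diff len)
      have "\<beta> ^ n * (x - z) \<le> \<beta> ^ n * (hole_length / \<beta> ^ n)" using x p by (intro mult_left_mono) auto
      thus "walk w x - walk w z \<le> hole_length" using basic_ineqs(1) by (simp add: walk_diff len)
    qed
    hence h: "1 / \<beta> \<le> walk w x" "walk w x \<le> 1 / (\<beta> * (\<beta> - 1))"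
      unfolding wz hole_length_def by simp_all
    have "walk w a \<le> walk w x" "walk w x \<le> walk w b" using h ab by simp_all
    hence "a \<le> x" "x \<le> b" unfolding walk_le_iff by simp_all
    thus "x \<in> {x \<in> cyl w. walk w x \<in> hole \<beta>}"
      using cyl_convex[OF ab(1,3)] h by (simp add: hole_def)
  qed
  thus ?thesis by blast
qed

lemma measure_first_entry_set_ge_branching:
  assumes "\<beta> < 2" "0 < n"
  shows "card (branching n) * (hole_length / 2 / \<beta> ^ n) \<le> measure lborel (first_entry_set \<beta> n)"
proof -
  define A where "A = {w \<in> branching n. \<not> hd w}"
  have "finite A" using finite_branching by (simp add: A_def)
  have "\<exists>z. {z..z + hole_length / \<beta> ^ n} \<subseteq> {x \<in> cyl w. walk w x \<in> hole \<beta>}" if "w \<in> A" for w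
    by (rule branching_interval) (use that in \<open>simp add: A_def\<close>)
  then obtain z where
    z: "\<And>w. w \<in> A \<Longrightarrow> {z w..z w + hole_length / \<beta> ^ n} \<subseteq> {x \<in> cyl w. walk w x \<in> hole \<beta>}"
    by metis
  define I where "I w = {z w..z w + hole_length / \<beta> ^ n}" for w
  have A: "length w = n" "\<exists>v. w = False # v" if "w \<in> A" for w
  proof -
    show "length w = n" using that by (simp add: A_def branching_def words_def)
    thus "\<exists>v. w = False # v" using that assms(2) by (cases w) (auto simp: A_def)
  qed
  have "disjoint_family_on I A"
    unfolding disjoint_family_on_def
  proof (intro ballI impI)
    fix u v assume uv: "u \<in> A" "v \<in> A" "u \<noteq> v"
    have False if "x \<in> I u" "x \<in> I v" for x
    proof -
      have "x \<in> cyl u" "x \<in> cyl v" using that uv z unfolding I_def by blast+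
      hence "hole_length \<le> \<beta> ^ length u * \<bar>x - x\<bar>"
        using uv A(1) by (intro cyl_separated[of u v]) auto
      thus False using hole_length_pos[OF assms(1)] by simp
    qed
    thus "I u \<inter> I v = {}" by blast
  qed
  hence "measure lborel (\<Union>w\<in>A. I w) = (\<Sum>w\<in>A. measure lborel (I w))"
    using \<open>finite A\<close> by (intro measure_finite_Union) (auto simp: I_def[abs_def] emeasure_lborel_Icc_eq)
  also have "\<dots> = card A * (hole_length / \<beta> ^ n)"
    using hole_length_nonneg basic_ineqs(1) by (simp add: I_def)
  finally have m: "measure lborel (\<Union>w\<in>A. I w) = card A * (hole_length / \<beta> ^ n)" .
  have "(\<Union>w\<in>A. I w) - boundary_hitting \<subseteq> first_entry_set \<beta> n"
  proof
    fix x assume "x \<in> (\<Union>w\<in>A. I w) - boundary_hitting"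
    then obtain w where w: "w \<in> A" "x \<in> cyl w" "walk w x \<in> hole \<beta>" "x \<notin> boundary_hitting"
      using z unfolding I_def by blast
    have "x \<in> {0..<1}" using A(2)[OF w(1)] w(2) basic_ineqs(4) by auto
    thus "x \<in> first_entry_set \<beta> n" using cyl_in_first_entry_set w A(1) by blast
  qed
  hence "card A * (hole_length / \<beta> ^ n) \<le> measure lborel (first_entry_set \<beta> n)"
    unfolding m[symmetric] using \<open>finite A\<close>
    by (intro measure_first_entry_set_ge) (auto simp: I_def intro!: sets.finite_UN)
  moreover have "real (card (branching n)) * (hole_length / 2 / \<beta> ^ n) \<le> (2 * card A) * (hole_length / 2 / \<beta> ^ n)"
    using card_branching_le_half[OF assms(2)] hole_length_nonneg basic_ineqs(1)
    by (intro mult_right_mono) (simp_all add: A_def)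
  ultimately show ?thesis by simp
qed

section \<open>The escape rate\<close>

lemma power_powr: "(\<beta> powr s) ^ n = \<beta> powr (s * n)"
  using basic_ineqs(1) by (simp add: powr_powr flip: powr_realpow)

lemma eventually_le_powr:
  assumes "0 < \<delta>"
  shows "\<forall>\<^sub>F n in sequentially. K \<le> \<beta> powr (\<delta> * real n)"
proof -
  have "1 < \<beta> powr \<delta>" using assms base_gt_1 by (simp add: gr_one_powr)
  then obtain N where N: "K < (\<beta> powr \<delta>) ^ N" using real_arch_pow by blast
  have "K \<le> \<beta> powr (\<delta> * real n)" if "N \<le> n" for n
  proof -
    have "(\<beta> powr \<delta>) ^ N \<le> (\<beta> powr \<delta>) ^ n"
      using that \<open>1 < \<beta> powr \<delta>\<close> by (intro power_increasing) auto
    thus ?thesis using N by (simp add: power_powr)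
  qed
  thus ?thesis unfolding eventually_sequentially by blast
qed

lemma eventually_measure_first_entry_set_le:
  assumes "0 < \<delta>"
  shows "\<forall>\<^sub>F n in sequentially.
    measure lborel (first_entry_set \<beta> n) \<le> \<beta> powr ((growth_exponent - 1 + \<delta>) * n)"
proof -
  define D where "D = growth_exponent"
  define L where "L = 2 / (\<beta> - 1)"
  have L: "0 < L" using basic_ineqs(2) by (simp add: L_def)
  have "growth_bound (D + \<delta> / 2)" using assms by (intro growth_bound_above) (simp add: D_def)
  then obtain C where C: "\<And>n. real (card (words n)) \<le> C * \<beta> powr ((D + \<delta> / 2) * n)"
    unfolding growth_bound_def power_powr by blast
  have "\<forall>\<^sub>F n in sequentially. C * L \<le> \<beta> powr (\<delta> / 2 * real n)"
    using assms by (intro eventually_le_powr) auto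
  thus ?thesis
  proof eventually_elim
    case (elim n)
    have p: "1 / \<beta> ^ n = \<beta> powr (- real n)"
      using basic_ineqs(1) by (simp add: powr_minus powr_realpow divide_inverse)
    have "measure lborel (first_entry_set \<beta> n) \<le> card (words n) * (L * \<beta> powr (- real n))"
      using measure_first_entry_set_le[of n] unfolding L_def[symmetric] p[symmetric] by simp
    also have "\<dots> \<le> (C * \<beta> powr ((D + \<delta> / 2) * n)) * (L * \<beta> powr (- real n))"
      using L by (intro mult_right_mono C) auto
    also have "\<dots> = (C * L) * (\<beta> powr ((D + \<delta> / 2) * n) * \<beta> powr (- real n))" by simp
    also have "\<dots> \<le> \<beta> powr (\<delta> / 2 * real n) * (\<beta> powr ((D + \<delta> / 2) * n) * \<beta> powr (- real n))"
      using elim by (intro mult_right_mono) auto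
    also have "\<dots> = \<beta> powr ((D - 1 + \<delta>) * n)"
      unfolding powr_add[symmetric] by (simp add: algebra_simps)
    finally show ?case unfolding D_def .
  qed
qed

text \<open>
  For \<open>D > 0\<close> the inequality \<open>a (n + t) \<le> a n + 2 ^ t * b n\<close> is used with \<open>t\<close> close to \<open>\<theta> * n\<close>. The left
  side is at least \<open>\<beta> powr (D * n + D * \<theta> * n)\<close> and \<open>a n\<close> is at most of order
  \<open>\<beta> powr (D * n + \<eta> * n)\<close>, so any \<open>\<eta> < D * \<theta>\<close> makes \<open>a n\<close> negligible; the loss \<open>2 ^ t\<close> is
  \<open>\<beta> powr (\<delta> / 2 * n)\<close> up to a factor 2.
\<close>
lemma eventually_measure_first_entry_set_ge:
  assumes "0 < \<delta>" "\<beta> < 2"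
  shows "\<forall>\<^sub>F n in sequentially.
    \<beta> powr ((growth_exponent - 1 - \<delta>) * n) \<le> measure lborel (first_entry_set \<beta> n)"
proof -
  define D where "D = growth_exponent"
  have \<beta>: "0 < \<beta>" using basic_ineqs(1) .
  have p: "1 / \<beta> ^ n = \<beta> powr (- real n)" for n
    using \<beta> by (simp add: powr_minus powr_realpow divide_inverse)
  consider "D = 0" | "0 < D" using growth_exponent_nonneg unfolding D_def by linarith
  thus ?thesis
  proof cases
    case 1
    obtain c where c: "0 < c" "\<And>n. 0 < n \<Longrightarrow> c / \<beta> ^ n \<le> measure lborel (first_entry_set \<beta> n)"
      using measure_first_entry_set_ge_power[OF assms(2)] by blast
    have "\<forall>\<^sub>F n in sequentially. 1 / c \<le> \<beta> powr (\<delta> * real n)"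
      by (rule eventually_le_powr[OF assms(1)])
    thus ?thesis using eventually_gt_at_top[of 0]
    proof eventually_elim
      case (elim n)
      have "\<beta> powr ((D - 1 - \<delta>) * n) = 1 / \<beta> powr (\<delta> * real n) * (1 / \<beta> ^ n)"
        unfolding p 1 by (simp add: algebra_simps powr_diff powr_minus divide_inverse)
      also have "\<dots> \<le> c * (1 / \<beta> ^ n)"
        using elim(1) c(1) \<beta> by (intro mult_right_mono) (simp_all add: field_simps)
      also have "\<dots> \<le> measure lborel (first_entry_set \<beta> n)" using c(2)[OF elim(2)] by simp
      finally show ?case unfolding D_def .
    qed
  next
    case 2
    define \<kappa> where "\<kappa> = log \<beta> 2"
    have \<kappa>: "0 < \<kappa>" "\<beta> powr \<kappa> = 2" using base_gt_1 by (simp_all add: \<kappa>_def)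
    define \<theta> where "\<theta> = \<delta> / (2 * \<kappa>)"
    have \<theta>: "0 < \<theta>" "\<kappa> * \<theta> = \<delta> / 2" using assms(1) \<kappa>(1) by (simp_all add: \<theta>_def)
    define \<eta> where "\<eta> = D * \<theta> / 2"
    have \<eta>: "0 < \<eta>" using 2 \<theta> by (simp add: \<eta>_def)
    have "growth_bound (D + \<eta>)" using \<eta> by (intro growth_bound_above) (simp add: D_def)
    then obtain C where C: "\<And>n. real (card (words n)) \<le> C * \<beta> powr ((D + \<eta>) * n)"
      unfolding growth_bound_def power_powr by blast
    have gap: "0 < hole_length" by (rule hole_length_pos[OF assms(2)])
    have "\<forall>\<^sub>F n in sequentially. max 1 (C + 1) \<le> \<beta> powr (\<eta> * real n)"
      by (rule eventually_le_powr[OF \<eta>])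
    moreover have "\<forall>\<^sub>F n in sequentially. 4 / hole_length \<le> \<beta> powr (\<delta> / 2 * real n)"
      using assms(1) by (intro eventually_le_powr) simp
    ultimately show ?thesis using eventually_gt_at_top[of 0]
    proof eventually_elim
      case (elim n)
      define t where "t = nat \<lceil>\<theta> * n\<rceil>"
      have t: "\<theta> * n \<le> t" "t \<le> \<theta> * n + 1"
        using \<theta>(1) by (simp_all add: t_def)
      define X where "X = \<beta> powr (\<eta> * n)"
      have X: "1 \<le> X" "C + 1 \<le> X" using elim(1) by (simp_all add: X_def)
      have "\<beta> powr (D * n) * (X * X) = \<beta> powr (D * n + D * (\<theta> * n))"
        unfolding X_def powr_add[symmetric] by (simp add: \<eta>_def algebra_simps)
      also have "\<dots> \<le> \<beta> powr (D * (n + t))"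
        using t(1) 2 base_gt_1 by (intro powr_mono) (simp_all add: distrib_left mult_left_mono)
      also have "\<dots> \<le> card (words (n + t))"
        using card_words_ge_growth[of "n + t"] by (simp add: power_powr D_def)
      also have "\<dots> \<le> real (card (words n)) + 2 ^ t * real (card (branching n))"
        using of_nat_mono[OF card_words_add_branching[of n t]] by simp
      also have "\<dots> \<le> C * \<beta> powr ((D + \<eta>) * n) + 2 ^ t * real (card (branching n))"
        using C[of n] by simp
      also have "C * \<beta> powr ((D + \<eta>) * n) = \<beta> powr (D * n) * (C * X)"
        by (simp add: X_def distrib_right powr_add)
      finally have "\<beta> powr (D * n) * (X * X - C * X) \<le> 2 ^ t * real (card (branching n))"
        by (simp add: right_diff_distrib)
      moreover have "1 * 1 \<le> X * (X - C)" using X by (intro mult_mono) auto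
      hence "\<beta> powr (D * n) * 1 \<le> \<beta> powr (D * n) * (X * X - C * X)"
        by (intro mult_left_mono) (simp_all add: algebra_simps)
      ultimately have b: "\<beta> powr (D * n) \<le> 2 ^ t * real (card (branching n))" by simp
      have "(2::real) ^ t = \<beta> powr (\<kappa> * t)" using power_powr[of \<kappa> t] \<kappa>(2) by simp
      also have "\<dots> \<le> \<beta> powr (\<kappa> * (\<theta> * n + 1))"
        using t(2) \<kappa>(1) base_gt_1 by (intro powr_mono) auto
      also have "\<kappa> * (\<theta> * n + 1) = \<delta> / 2 * n + \<kappa>"
        using \<theta>(2) by (simp add: distrib_left flip: mult.assoc)
      finally have "2 ^ t \<le> 2 * \<beta> powr (\<delta> / 2 * n)" by (simp add: powr_add \<kappa>(2) mult.commute)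
      hence "2 ^ t * real (card (branching n)) \<le> 2 * \<beta> powr (\<delta> / 2 * n) * card (branching n)"
        by (rule mult_right_mono) simp
      hence b2: "\<beta> powr (D * n) \<le> 2 * \<beta> powr (\<delta> / 2 * n) * card (branching n)"
        using b by linarith
      have "\<beta> powr ((D - 1 - \<delta>) * n) = \<beta> powr (D * n) * (\<beta> powr (- \<delta> * n) * (1 / \<beta> ^ n))"
        unfolding p powr_add[symmetric] by (simp add: algebra_simps)
      also have "\<dots> \<le> (2 * \<beta> powr (\<delta> / 2 * n) * card (branching n)) * (\<beta> powr (- \<delta> * n) * (1 / \<beta> ^ n))"
        using \<beta> by (intro mult_right_mono b2) auto
      also have "\<dots> = 2 * (\<beta> powr (\<delta> / 2 * n) * \<beta> powr (- \<delta> * n)) * (card (branching n) / \<beta> ^ n)"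
        by simp
      also have "\<beta> powr (\<delta> / 2 * n) * \<beta> powr (- \<delta> * n) = 1 / \<beta> powr (\<delta> / 2 * n)"
        unfolding powr_add[symmetric] using \<beta> by (simp add: powr_minus_divide[symmetric] algebra_simps)
      also have "2 * (1 / \<beta> powr (\<delta> / 2 * n)) * (card (branching n) / \<beta> ^ n)
          \<le> (hole_length / 2) * (card (branching n) / \<beta> ^ n)"
        using elim(2) gap \<beta> by (intro mult_right_mono) (simp_all add: field_simps)
      also have "\<dots> \<le> measure lborel (first_entry_set \<beta> n)"
        using measure_first_entry_set_ge_branching[OF assms(2) elim(3)] by (simp add: mult.commute)
      finally show ?case unfolding D_def .
    qed
  qed
qed

lemma escape_seq_tendsto:
  assumes "\<beta> < 2"
  shows "escape_seq \<beta> \<longlonglongrightarrow> 1 - growth_exponent"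
proof (rule tendstoI)
  fix e :: real assume "0 < e"
  define D where "D = growth_exponent"
  have e2: "0 < e / 2" using \<open>0 < e\<close> by simp
  show "\<forall>\<^sub>F n in sequentially. dist (escape_seq \<beta> n) (1 - growth_exponent) < e"
    using eventually_measure_first_entry_set_le[OF e2]
      eventually_measure_first_entry_set_ge[OF e2 assms] eventually_gt_at_top[of 0]
  proof eventually_elim
    case (elim n)
    define m where "m = measure lborel (first_entry_set \<beta> n)"
    have "0 < \<beta> powr ((D - 1 - e / 2) * n)" using basic_ineqs(1) by simp
    hence m: "0 < m" using elim(2) unfolding m_def D_def by linarith
    have l: "0 < n * ln \<beta>" using elim(3) base_gt_1 by simp
    have "ln m \<le> ln (\<beta> powr ((D - 1 + e / 2) * n))"
      by (rule iffD2[OF ln_le_cancel_iff]) (use elim(1) m basic_ineqs(1) in \<open>simp_all add: m_def D_def\<close>)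
    hence 1: "ln m \<le> (D - 1 + e / 2) * (n * ln \<beta>)" by (simp add: ln_powr)
    have "ln (\<beta> powr ((D - 1 - e / 2) * n)) \<le> ln m"
      by (rule iffD2[OF ln_le_cancel_iff]) (use elim(2) m basic_ineqs(1) in \<open>simp_all add: m_def D_def\<close>)
    hence 2: "(D - 1 - e / 2) * (n * ln \<beta>) \<le> ln m" by (simp add: ln_powr)
    have "escape_seq \<beta> n = - (ln m / (n * ln \<beta>))" by (simp add: escape_seq_def m_def)
    moreover have "ln m / (n * ln \<beta>) \<le> D - 1 + e / 2" using 1 l by (simp only: pos_divide_le_eq)
    moreover have "D - 1 - e / 2 \<le> ln m / (n * ln \<beta>)" using 2 l by (simp only: pos_le_divide_eq)
    ultimately show ?case using \<open>0 < e\<close> by (simp add: dist_real_def D_def abs_less_iff)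
  qed
qed

section \<open>Base 2\<close>

lemma escape_seq_base_2:
  assumes "\<beta> = 2"
  shows "escape_seq \<beta> = (\<lambda>_. 0)"
proof -
  have "measure lborel (first_entry_set \<beta> n) = 0" for n
  proof -
    have "first_entry_set \<beta> n \<subseteq> boundary_hitting"
    proof
      fix x assume x: "x \<in> first_entry_set \<beta> n"
      then obtain w where "walk w x = (greedy_map \<beta> ^^ n) x"
        using greedy_survivor_in_cyl unfolding first_entry_set_def by blast
      hence "walk w x \<in> hole \<beta>" using x by (simp add: first_entry_set_def)
      hence "walk w x = 1 / \<beta>" by (simp add: hole_def assms)
      thus "x \<in> boundary_hitting" unfolding boundary_hitting_def by blast
    qed
    hence "countable (first_entry_set \<beta> n)" using countable_boundary_hitting countable_subset by blast
    hence "first_entry_set \<beta> n \<in> null_sets lborel" by (rule countable_imp_null_set_lborel)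
    thus ?thesis by (simp add: measure_eq_0_null_sets)
  qed
  thus ?thesis by (simp add: escape_seq_def fun_eq_iff)
qed

lemma unit_interval_subset_base_2:
  assumes "\<beta> = 2"
  shows "{0..1} - boundary_hitting \<subseteq> univoque_set \<beta>"
proof
  fix x :: real assume x: "x \<in> {0..1} - boundary_hitting"
  hence "x \<in> {0 .. 1 / (\<beta> - 1)}" using assms by simp
  then obtain \<epsilon> where \<epsilon>: "beta_expansion \<beta> x \<epsilon>" using beta_expansion_exists by blast
  have "x \<in> cyl (map (\<lambda>i. \<epsilon> i = 1) [0..<n])" for n
    using \<epsilon>
  proof (induction n arbitrary: x \<epsilon>)
    case 0
    thus ?case using beta_expansion_range by simp
  next
    case (Suc n)
    have \<epsilon>: "\<epsilon> 0 \<in> {0, 1}" "beta_expansion \<beta> (\<beta> * x - real (\<epsilon> 0)) (\<lambda>i. \<epsilon> (Suc i))"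
      using Suc.prems beta_expansion_step by blast+
    have r: "\<beta> * x - real (\<epsilon> 0) \<in> {0 .. 1 / (\<beta> - 1)}" by (rule beta_expansion_range[OF \<epsilon>(2)])
    have d: "real (\<epsilon> 0) = of_bool (\<epsilon> 0 = 1)" using \<epsilon>(1) by auto
    have b: "1 / \<beta> = 1 / 2" "1 / (\<beta> * (\<beta> - 1)) = 1 / 2" "1 / (\<beta> - 1) = 1"
      using assms by simp_all
    have "2 * x - real (\<epsilon> 0) \<in> {0..1}" using r assms by simp
    hence "x \<in> branch (\<epsilon> 0 = 1)" using \<epsilon>(1) by (auto simp: b)
    thus ?case using Suc.IH[OF \<epsilon>(2)] d unfolding map_upt_Suc by simp
  qed
  hence "itinerary (\<lambda>i. \<epsilon> i = 1) x" unfolding itinerary_def by blast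
  thus "x \<in> univoque_set \<beta>" using x itinerary_univoque by blast
qed

text \<open>
  The univoque set has full Lebesgue measure in the unit interval, and for \<open>s \<le> 1\<close> the
  \<open>s\<close>-dimensional weight of a set of diameter at most 1 dominates half the length of an interval
  that contains it.
\<close>
lemma hausdorff_dim_base_2:
  assumes "\<beta> = 2"
  shows "hausdorff_dim (univoque_set \<beta>) = ereal 1"
proof (rule hausdorff_dim_eqI)
  fix s :: real assume "1 < s"
  moreover have "growth_exponent \<le> 1" using growth_exponent_le[OF growth_bound_trivial] assms by simp
  ultimately show "hausdorff_measure s (univoque_set \<beta>) = 0"
    by (intro hausdorff_null_above_growth) simp
next
  fix s :: real assume s: "0 \<le> s" and null: "hausdorff_measure s (univoque_set \<beta>) = 0"
  show "1 \<le> s"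
  proof (rule ccontr)
    assume "\<not> 1 \<le> s"
    have "s \<noteq> 0" using hausdorff_nonnull_0[of "univoque_set \<beta>"] zero_univoque null by auto
    hence s: "0 < s" "s < 1" using s \<open>\<not> 1 \<le> s\<close> by auto
    obtain C where C: "univoque_set \<beta> \<subseteq> (\<Union>i. C i)" "\<And>i. bounded (C i)" "\<And>i. diameter (C i) \<le> 1"
      and sum: "(\<Sum>i. hausdorff_weight s (C i)) < ennreal (1 / 2)"
      using hausdorff_null_cover[OF null, of 1 "1 / 2"] by (metis half_gt_zero zero_less_one)
    have "\<exists>y. C i \<subseteq> {y - diameter (C i)..y + diameter (C i)}" for i
    proof (cases "C i = {}")
      case False
      then obtain y where y: "y \<in> C i" by blast
      have "\<bar>x - y\<bar> \<le> diameter (C i)" if "x \<in> C i" for x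
        using diameter_bounded_bound[OF C(2) that y] by (simp add: dist_real_def)
      thus ?thesis by (intro exI[of _ y]) (auto simp: abs_le_iff algebra_simps)
    qed simp
    then obtain y where y: "\<And>i. C i \<subseteq> {y i - diameter (C i)..y i + diameter (C i)}" by metis
    define I where "I i = {y i - diameter (C i)..y i + diameter (C i)}" for i
    have d: "0 \<le> diameter (C i)" for i using C(2) by (rule diameter_ge_0)
    have "(\<Union>i. C i) \<subseteq> (\<Union>i. I i)" using y unfolding I_def by (intro UN_mono) simp_all
    hence cover: "{0..1} - boundary_hitting \<subseteq> (\<Union>i. I i)"
      using unit_interval_subset_base_2[OF assms] C(1) by (meson subset_trans)
    have "ennreal 1 = emeasure lborel {0..1::real}" by simp
    also have "\<dots> = emeasure lborel ({0..1} - boundary_hitting)"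
      using emeasure_Diff_null_set[OF countable_imp_null_set_lborel[OF countable_boundary_hitting],
          of "{0..1}"] by simp
    also have "\<dots> \<le> emeasure lborel (\<Union>i. I i)"
      using cover by (rule emeasure_mono) (auto simp: I_def)
    also have "\<dots> \<le> (\<Sum>i. emeasure lborel (I i))"
      by (intro emeasure_subadditive_countably) (auto simp: I_def)
    also have "\<dots> \<le> (\<Sum>i. 2 * hausdorff_weight s (C i))"
    proof (intro suminf_le summableI)
      fix i
      have "diameter (C i) powr 1 \<le> diameter (C i) powr s"
        by (rule powr_mono') (use d C(3) s in simp_all)
      hence "diameter (C i) \<le> diameter (C i) powr s" using d[of i] by simp
      hence "ennreal (2 * diameter (C i)) \<le> ennreal (2 * diameter (C i) powr s)"
        using d[of i] by (intro ennreal_leI) simp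
      thus "emeasure lborel (I i) \<le> 2 * hausdorff_weight s (C i)"
        using d[of i] s by (simp add: I_def hausdorff_weight_pos ennreal_mult)
    qed
    also have "\<dots> = 2 * (\<Sum>i. hausdorff_weight s (C i))" by simp
    also have "\<dots> < 2 * ennreal (1 / 2)" using sum by (intro ennreal_mult_strict_left_mono) auto
    also have "\<dots> = ennreal (2 * (1 / 2))" by (subst ennreal_mult) auto
    finally show False by simp
  qed
qed simp

end

theorem theorem1p7:
  fixes \<beta> :: real
  assumes "1 < \<beta>" and "\<beta> \<le> 2"
  shows "convergent (escape_seq \<beta>) \<and>
         hausdorff_dim (univoque_set \<beta>) + ereal (escape_rate \<beta>) = 1"
proof -
  interpret expansion_base \<beta> using assms by unfold_locales
  obtain D where dim: "hausdorff_dim (univoque_set \<beta>) = ereal D"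
    and lim: "escape_seq \<beta> \<longlonglongrightarrow> 1 - D"
  proof (cases "\<beta> = 2")
    case True
    show thesis
      by (rule that[of 1]) (use True hausdorff_dim_base_2 escape_seq_base_2 in auto)
  next
    case False
    hence "\<beta> < 2" using assms(2) by simp
    thus thesis using that hausdorff_dim_univoque escape_seq_tendsto by blast
  qed
  have "escape_rate \<beta> = 1 - D" unfolding escape_rate_def by (rule limI[OF lim])
  thus ?thesis using dim lim by (auto simp: convergent_def one_ereal_def)
qed

end
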